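(* Let $\mathcal{C}$ be a symmetric monoidal category and $\mathbb{P}$ a prop. For any supply of $\mathbb{P}$ in $\mathcal{C}$, there is an induced supply of $\mathbb{P}$ in the strictification $\overline{\mathcal{C}}$ of $\mathcal{C}$.
   Context: Strong monoidal functors between symmetric monoidal categories are understood to be symmetric; their structure isomorphisms are called strongators. In a symmetric monoidal category $(\mathcal{C},I,\otimes)$, write $b^{\otimes m}$ for the left-bracketed $m$-fold product $((b\otimes b)\otimes\cdots)\otimes b$, with $b^{\otimes 0}=I$ and $b^{\otimes 1}=b$. Write $\sigma\colon c^{\otimes n}\otimes d^{\otimes n}\to(c\otimes d)^{\otimes n}$ and $\sigma\colon I\to I^{\otimes n}$ for the canonical (Mac Lane coherence) isomorphisms, the first one realizing the evident shuffle permutation. A prop is a symmetric strict monoidal category whose monoid of objects is $(\mathbb{N},0,+)$. A supply $s$ of a prop $\mathbb{P}$ in $\mathcal{C}$ consists of a strong monoidal functor $s_c\colon\mathbb{P}\to\mathcal{C}$ for each object $c\in\mathcal{C}$ such that: (i) $s_c(m)=c^{\otimes m}$ for each $m\in\mathbb{N}$; (ii) the strongator $c^{\otimes m}\otimes c^{\otimes n}\to c^{\otimes(m+n)}$ is the unique coherence isomorphism (the rebracketing) for each $m,n\in\mathbb{N}$; (iii) for all $c,d\in\mathcal{C}$ and $\mu\colon m\to n$ in $\mathbb{P}$, $s_{c\otimes d}(\mu)\circ\sigma=\sigma\circ(s_c(\mu)\otimes s_d(\mu))$ as maps $c^{\otimes m}\otimes d^{\otimes m}\to(c\otimes d)^{\otimes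 n}$, and $s_I(\mu)\circ\sigma=\sigma$ as maps $I\to I^{\otimes n}$. The strictification $\overline{\mathcal{C}}$ is Mac Lane's strictification: its objects are finite lists $[c_1,\dots,c_k]$ ($k\ge 0$) of objects of $\mathcal{C}$; a morphism $[c_1,\dots,c_k]\to[d_1,\dots,d_l]$ is a morphism $c_1\otimes\cdots\otimes c_k\to d_1\otimes\cdots\otimes d_l$ in $\mathcal{C}$ (left-bracketed products, the empty product being $I$); the monoidal product is concatenation of lists on objects and is given on morphisms by $\otimes$ in $\mathcal{C}$ conjugated by coherence isomorphisms; the unit is the empty list; the braiding is induced from that of $\mathcal{C}$. It is a symmetric strict monoidal category, strongly monoidally equivalent to $\mathcal{C}$ via the functor sending a list to its left-bracketed product. *)

theory Defs
  imports Main
begin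

section \<open>Symmetric monoidal categories\<close>

record ('o, 'm) smc =
  Obj :: "'o set"
  Arr :: "'m set"
  Dom :: "'m \<Rightarrow> 'o"
  Cod :: "'m \<Rightarrow> 'o"
  Ident :: "'o \<Rightarrow> 'm"
  Comp :: "'m \<Rightarrow> 'm \<Rightarrow> 'm"  (infixr "\<cdot>\<index>" 65)
  Unit :: 'o
  TensO :: "'o \<Rightarrow> 'o \<Rightarrow> 'o"  (infixl "\<otimes>\<index>" 75)
  TensA :: "'m \<Rightarrow> 'm \<Rightarrow> 'm"  (infixl "\<boxtimes>\<index>" 75)
  Assoc :: "'o \<Rightarrow> 'o \<Rightarrow> 'o \<Rightarrow> 'm"
  LUnit :: "'o \<Rightarrow> 'm"
  RUnit :: "'o \<Rightarrow> 'm"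
  Braid :: "'o \<Rightarrow> 'o \<Rightarrow> 'm"

text \<open>
  \<open>g \<cdot> f\<close> is the composite of \<open>f\<close> followed by \<open>g\<close>.  The structure maps are oriented as
  \<open>Assoc a b c : (a \<otimes> b) \<otimes> c \<rightarrow> a \<otimes> (b \<otimes> c)\<close>, \<open>LUnit a : Unit \<otimes> a \<rightarrow> a\<close>,
  \<open>RUnit a : a \<otimes> Unit \<rightarrow> a\<close> and \<open>Braid a b : a \<otimes> b \<rightarrow> b \<otimes> a\<close>.
  Operations are only constrained on \<open>Obj\<close> and \<open>Arr\<close>.
\<close>

definition hom :: "('o, 'm) smc \<Rightarrow> 'o \<Rightarrow> 'o \<Rightarrow> 'm set" where
  "hom C a b = {f \<in> Arr C. Dom C f = a \<and> Cod C f = b}"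

definition inverse_arrows :: "('o, 'm) smc \<Rightarrow> 'm \<Rightarrow> 'm \<Rightarrow> bool" where
  "inverse_arrows C f g \<longleftrightarrow>
     f \<in> Arr C \<and> g \<in> hom C (Cod C f) (Dom C f) \<and>
     g \<cdot>\<^bsub>C\<^esub> f = Ident C (Dom C f) \<and> f \<cdot>\<^bsub>C\<^esub> g = Ident C (Cod C f)"

definition isos :: "('o, 'm) smc \<Rightarrow> 'o \<Rightarrow> 'o \<Rightarrow> 'm set" where
  "isos C a b = {f \<in> hom C a b. \<exists>g. inverse_arrows C f g}"

definition inv_arr :: "('o, 'm) smc \<Rightarrow> 'm \<Rightarrow> 'm" where
  "inv_arr C f = (THE g. inverse_arrows C f g)"

locale category =
  fixes C :: "('o, 'm) smc" (structure)
  assumes Dom_Obj: "f \<in> Arr C \<Longrightarrow> Dom C f \<in> Obj C"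
    and Cod_Obj: "f \<in> Arr C \<Longrightarrow> Cod C f \<in> Obj C"
    and Ident_hom: "a \<in> Obj C \<Longrightarrow> Ident C a \<in> hom C a a"
    and Comp_hom: "f \<in> hom C a b \<Longrightarrow> g \<in> hom C b c \<Longrightarrow> g \<cdot> f \<in> hom C a c"
    and Comp_Ident_left: "f \<in> hom C a b \<Longrightarrow> Ident C b \<cdot> f = f"
    and Comp_Ident_right: "f \<in> hom C a b \<Longrightarrow> f \<cdot> Ident C a = f"
    and Comp_assoc: "f \<in> hom C a b \<Longrightarrow> g \<in> hom C b c \<Longrightarrow> h \<in> hom C c d \<Longrightarrow>
      h \<cdot> (g \<cdot> f) = (h \<cdot> g) \<cdot> f"

locale monoidal_category = category +
  assumes Unit_Obj: "Unit C \<in> Obj C"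
    and TensO_Obj: "a \<in> Obj C \<Longrightarrow> b \<in> Obj C \<Longrightarrow> a \<otimes> b \<in> Obj C"
    and TensA_hom: "f \<in> hom C a a' \<Longrightarrow> g \<in> hom C b b' \<Longrightarrow> f \<boxtimes> g \<in> hom C (a \<otimes> b) (a' \<otimes> b')"
    and TensA_Ident: "a \<in> Obj C \<Longrightarrow> b \<in> Obj C \<Longrightarrow> Ident C a \<boxtimes> Ident C b = Ident C (a \<otimes> b)"
    and interchange: "f \<in> hom C a b \<Longrightarrow> g \<in> hom C b c \<Longrightarrow> f' \<in> hom C a' b' \<Longrightarrow> g' \<in> hom C b' c' \<Longrightarrow>
      (g \<cdot> f) \<boxtimes> (g' \<cdot> f') = (g \<boxtimes> g') \<cdot> (f \<boxtimes> f')"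
    and Assoc_iso: "a \<in> Obj C \<Longrightarrow> b \<in> Obj C \<Longrightarrow> c \<in> Obj C \<Longrightarrow>
      Assoc C a b c \<in> isos C ((a \<otimes> b) \<otimes> c) (a \<otimes> (b \<otimes> c))"
    and LUnit_iso: "a \<in> Obj C \<Longrightarrow> LUnit C a \<in> isos C (Unit C \<otimes> a) a"
    and RUnit_iso: "a \<in> Obj C \<Longrightarrow> RUnit C a \<in> isos C (a \<otimes> Unit C) a"
    and Assoc_natural: "f \<in> hom C a a' \<Longrightarrow> g \<in> hom C b b' \<Longrightarrow> h \<in> hom C c c' \<Longrightarrow>
      Assoc C a' b' c' \<cdot> ((f \<boxtimes> g) \<boxtimes> h) = (f \<boxtimes> (g \<boxtimes> h)) \<cdot> Assoc C a b c"
    and LUnit_natural: "f \<in> hom C a a' \<Longrightarrow>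
      LUnit C a' \<cdot> (Ident C (Unit C) \<boxtimes> f) = f \<cdot> LUnit C a"
    and RUnit_natural: "f \<in> hom C a a' \<Longrightarrow>
      RUnit C a' \<cdot> (f \<boxtimes> Ident C (Unit C)) = f \<cdot> RUnit C a"
    and pentagon: "a \<in> Obj C \<Longrightarrow> b \<in> Obj C \<Longrightarrow> c \<in> Obj C \<Longrightarrow> d \<in> Obj C \<Longrightarrow>
      Assoc C a b (c \<otimes> d) \<cdot> Assoc C (a \<otimes> b) c d =
      (Ident C a \<boxtimes> Assoc C b c d) \<cdot> Assoc C a (b \<otimes> c) d \<cdot> (Assoc C a b c \<boxtimes> Ident C d)"
    and triangle: "a \<in> Obj C \<Longrightarrow> b \<in> Obj C \<Longrightarrow>
      (Ident C a \<boxtimes> LUnit C b) \<cdot> Assoc C a (Unit C) b = RUnit C a \<boxtimes> Ident C b"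

locale symmetric_monoidal_category = monoidal_category +
  assumes Braid_hom: "a \<in> Obj C \<Longrightarrow> b \<in> Obj C \<Longrightarrow> Braid C a b \<in> hom C (a \<otimes> b) (b \<otimes> a)"
    and Braid_natural: "f \<in> hom C a a' \<Longrightarrow> g \<in> hom C b b' \<Longrightarrow>
      Braid C a' b' \<cdot> (f \<boxtimes> g) = (g \<boxtimes> f) \<cdot> Braid C a b"
    and Braid_symmetric: "a \<in> Obj C \<Longrightarrow> b \<in> Obj C \<Longrightarrow>
      Braid C b a \<cdot> Braid C a b = Ident C (a \<otimes> b)"
    and hexagon: "a \<in> Obj C \<Longrightarrow> b \<in> Obj C \<Longrightarrow> c \<in> Obj C \<Longrightarrow>
      Assoc C b c a \<cdot> Braid C a (b \<otimes> c) \<cdot> Assoc C a b c =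
      (Ident C b \<boxtimes> Braid C a c) \<cdot> Assoc C b a c \<cdot> (Braid C a b \<boxtimes> Ident C c)"

locale symmetric_strict_monoidal_category = symmetric_monoidal_category +
  assumes TensO_assoc: "a \<in> Obj C \<Longrightarrow> b \<in> Obj C \<Longrightarrow> c \<in> Obj C \<Longrightarrow>
      (a \<otimes> b) \<otimes> c = a \<otimes> (b \<otimes> c)"
    and TensO_Unit_left: "a \<in> Obj C \<Longrightarrow> Unit C \<otimes> a = a"
    and TensO_Unit_right: "a \<in> Obj C \<Longrightarrow> a \<otimes> Unit C = a"
    and Assoc_Ident: "a \<in> Obj C \<Longrightarrow> b \<in> Obj C \<Longrightarrow> c \<in> Obj C \<Longrightarrow>
      Assoc C a b c = Ident C (a \<otimes> b \<otimes> c)"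
    and LUnit_Ident: "a \<in> Obj C \<Longrightarrow> LUnit C a = Ident C a"
    and RUnit_Ident: "a \<in> Obj C \<Longrightarrow> RUnit C a = Ident C a"

locale prop_category = symmetric_strict_monoidal_category P
  for P :: "(nat, 'p) smc" +
  assumes Obj_UNIV: "Obj P = UNIV"
    and Unit_zero: "Unit P = 0"
    and TensO_plus: "TensO P m n = m + n"


section \<open>Canonical isomorphisms\<close>

text \<open>Left-bracketed products \<open>((c\<^sub>1 \<otimes> c\<^sub>2) \<otimes> \<dots>) \<otimes> c\<^sub>k\<close>.\<close>

definition tens :: "('o, 'm) smc \<Rightarrow> 'o list \<Rightarrow> 'o" where
  "tens C L = (case L of [] \<Rightarrow> Unit C | c # cs \<Rightarrow> foldl (TensO C) c cs)"

lemma tens_simps [simp]: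
  "tens C [] = Unit C"
  "tens C [c] = c"
  "L \<noteq> [] \<Longrightarrow> tens C (L @ [c]) = tens C L \<otimes>\<^bsub>C\<^esub> c"
  by (auto simp: tens_def split: list.splits)

definition tpow :: "('o, 'm) smc \<Rightarrow> 'o \<Rightarrow> nat \<Rightarrow> 'o" where
  "tpow C b m = tens C (replicate m b)"

lemma tpow_simps [simp]:
  "tpow C b 0 = Unit C"
  "tpow C b (Suc 0) = b"
  "tpow C b (Suc (Suc m)) = tpow C b (Suc m) \<otimes>\<^bsub>C\<^esub> b"
  using tens_simps(3)[of "replicate (Suc m) b" C b]
  by (simp_all add: tpow_def replicate_append_same)

text \<open>
  The rebracketing \<open>tens L \<otimes> tens M \<rightarrow> tens (L @ M)\<close>, built from associators and unitors by
  recursion on \<open>M\<close> from the right.  By Mac Lane coherence it is the only such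
  composite, so the choice of recursion is immaterial.
\<close>

function rebracket :: "('o, 'm) smc \<Rightarrow> 'o list \<Rightarrow> 'o list \<Rightarrow> 'm" where
  "rebracket C L M =
    (if M = [] then RUnit C (tens C L)
     else if L = [] then LUnit C (tens C M)
     else if length M = 1 then Ident C (tens C (L @ M))
     else (rebracket C L (butlast M) \<boxtimes>\<^bsub>C\<^esub> Ident C (last M)) \<cdot>\<^bsub>C\<^esub>
          inv_arr C (Assoc C (tens C L) (tens C (butlast M)) (last M)))"
  by pat_completeness auto
termination
  by (relation "measure (\<lambda>(C, L, M). length M)") auto

declare rebracket.simps [simp del]

lemma rebracket_simps:
  "rebracket C L [] = RUnit C (tens C L)"
  "M \<noteq> [] \<Longrightarrow> rebracket C [] M = LUnit C (tens C M)"
  "L \<noteq> [] \<Longrightarrow> rebracket C L [c] = Ident C (tens C L \<otimes>\<^bsub>C\<^esub> c)"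
  "L \<noteq> [] \<Longrightarrow> M \<noteq> [] \<Longrightarrow> rebracket C L (M @ [c]) =
     (rebracket C L M \<boxtimes>\<^bsub>C\<^esub> Ident C c) \<cdot>\<^bsub>C\<^esub> inv_arr C (Assoc C (tens C L) (tens C M) c)"
  by (subst rebracket.simps, simp)+

text \<open>The symmetry \<open>(a \<otimes> b) \<otimes> (c \<otimes> d) \<rightarrow> (a \<otimes> c) \<otimes> (b \<otimes> d)\<close> exchanging the middle factors.\<close>

definition middle_swap :: "('o, 'm) smc \<Rightarrow> 'o \<Rightarrow> 'o \<Rightarrow> 'o \<Rightarrow> 'o \<Rightarrow> 'm" where
  "middle_swap C a b c d =
     inv_arr C (Assoc C a c (b \<otimes>\<^bsub>C\<^esub> d)) \<cdot>\<^bsub>C\<^esub>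
     (Ident C a \<boxtimes>\<^bsub>C\<^esub> Assoc C c b d) \<cdot>\<^bsub>C\<^esub>
     (Ident C a \<boxtimes>\<^bsub>C\<^esub> (Braid C b c \<boxtimes>\<^bsub>C\<^esub> Ident C d)) \<cdot>\<^bsub>C\<^esub>
     (Ident C a \<boxtimes>\<^bsub>C\<^esub> inv_arr C (Assoc C b c d)) \<cdot>\<^bsub>C\<^esub>
     Assoc C a b (c \<otimes>\<^bsub>C\<^esub> d)"

text \<open>
  The canonical isomorphism \<open>c\<^sup>\<otimes>\<^sup>n \<otimes> d\<^sup>\<otimes>\<^sup>n \<rightarrow> (c \<otimes> d)\<^sup>\<otimes>\<^sup>n\<close> pairing the \<open>i\<close>-th factor \<open>c\<close> with the
  \<open>i\<close>-th factor \<open>d\<close>, and the canonical isomorphism \<open>I \<rightarrow> I\<^sup>\<otimes>\<^sup>n\<close>.  As for \<^const>\<open>rebracket\<close>,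
  coherence makes every composite of structure maps with the same underlying permutation
  equal to these.
\<close>

fun shuffle :: "('o, 'm) smc \<Rightarrow> 'o \<Rightarrow> 'o \<Rightarrow> nat \<Rightarrow> 'm" where
  "shuffle C c d 0 = LUnit C (Unit C)"
| "shuffle C c d (Suc 0) = Ident C (c \<otimes>\<^bsub>C\<^esub> d)"
| "shuffle C c d (Suc (Suc n)) =
     (shuffle C c d (Suc n) \<boxtimes>\<^bsub>C\<^esub> Ident C (c \<otimes>\<^bsub>C\<^esub> d)) \<cdot>\<^bsub>C\<^esub>
     middle_swap C (tpow C c (Suc n)) c (tpow C d (Suc n)) d"

fun unit_shuffle :: "('o, 'm) smc \<Rightarrow> nat \<Rightarrow> 'm" where
  "unit_shuffle C 0 = Ident C (Unit C)"
| "unit_shuffle C (Suc 0) = Ident C (Unit C)"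
| "unit_shuffle C (Suc (Suc n)) =
     (unit_shuffle C (Suc n) \<boxtimes>\<^bsub>C\<^esub> Ident C (Unit C)) \<cdot>\<^bsub>C\<^esub> inv_arr C (LUnit C (Unit C))"


section \<open>Strong monoidal functors\<close>

record ('a, 'f, 'b, 'g) monoidal_functor =
  OMap :: "'a \<Rightarrow> 'b"
  AMap :: "'f \<Rightarrow> 'g"
  Strongator :: "'a \<Rightarrow> 'a \<Rightarrow> 'g"
  UStrongator :: 'g

text \<open>
  Strong monoidal functors are symmetric by convention.  The strongators are
  \<open>F a \<otimes> F b \<rightarrow> F (a \<otimes> b)\<close> and \<open>I \<rightarrow> F I\<close>.
\<close>

locale strong_monoidal_functor =
  A: symmetric_monoidal_category A + B: symmetric_monoidal_category B
  for A :: "('a, 'f) smc" and B :: "('b, 'g) smc" +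
  fixes F :: "('a, 'f, 'b, 'g) monoidal_functor"
  assumes OMap_Obj: "a \<in> Obj A \<Longrightarrow> OMap F a \<in> Obj B"
    and AMap_hom: "f \<in> hom A a b \<Longrightarrow> AMap F f \<in> hom B (OMap F a) (OMap F b)"
    and AMap_Ident: "a \<in> Obj A \<Longrightarrow> AMap F (Ident A a) = Ident B (OMap F a)"
    and AMap_Comp: "f \<in> hom A a b \<Longrightarrow> g \<in> hom A b c \<Longrightarrow>
      AMap F (g \<cdot>\<^bsub>A\<^esub> f) = AMap F g \<cdot>\<^bsub>B\<^esub> AMap F f"
    and Strongator_iso: "a \<in> Obj A \<Longrightarrow> b \<in> Obj A \<Longrightarrow>
      Strongator F a b \<in> isos B (OMap F a \<otimes>\<^bsub>B\<^esub> OMap F b) (OMap F (a \<otimes>\<^bsub>A\<^esub> b))"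
    and UStrongator_iso: "UStrongator F \<in> isos B (Unit B) (OMap F (Unit A))"
    and Strongator_natural: "f \<in> hom A a a' \<Longrightarrow> g \<in> hom A b b' \<Longrightarrow>
      Strongator F a' b' \<cdot>\<^bsub>B\<^esub> (AMap F f \<boxtimes>\<^bsub>B\<^esub> AMap F g) =
      AMap F (f \<boxtimes>\<^bsub>A\<^esub> g) \<cdot>\<^bsub>B\<^esub> Strongator F a b"
    and Strongator_Assoc: "a \<in> Obj A \<Longrightarrow> b \<in> Obj A \<Longrightarrow> c \<in> Obj A \<Longrightarrow>
      AMap F (Assoc A a b c) \<cdot>\<^bsub>B\<^esub> Strongator F (a \<otimes>\<^bsub>A\<^esub> b) c \<cdot>\<^bsub>B\<^esub>
        (Strongator F a b \<boxtimes>\<^bsub>B\<^esub> Ident B (OMap F c)) =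
      Strongator F a (b \<otimes>\<^bsub>A\<^esub> c) \<cdot>\<^bsub>B\<^esub> (Ident B (OMap F a) \<boxtimes>\<^bsub>B\<^esub> Strongator F b c) \<cdot>\<^bsub>B\<^esub>
        Assoc B (OMap F a) (OMap F b) (OMap F c)"
    and Strongator_LUnit: "a \<in> Obj A \<Longrightarrow>
      AMap F (LUnit A a) \<cdot>\<^bsub>B\<^esub> Strongator F (Unit A) a \<cdot>\<^bsub>B\<^esub>
        (UStrongator F \<boxtimes>\<^bsub>B\<^esub> Ident B (OMap F a)) =
      LUnit B (OMap F a)"
    and Strongator_RUnit: "a \<in> Obj A \<Longrightarrow>
      AMap F (RUnit A a) \<cdot>\<^bsub>B\<^esub> Strongator F a (Unit A) \<cdot>\<^bsub>B\<^esub>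
        (Ident B (OMap F a) \<boxtimes>\<^bsub>B\<^esub> UStrongator F) =
      RUnit B (OMap F a)"
    and Strongator_Braid: "a \<in> Obj A \<Longrightarrow> b \<in> Obj A \<Longrightarrow>
      AMap F (Braid A a b) \<cdot>\<^bsub>B\<^esub> Strongator F a b =
      Strongator F b a \<cdot>\<^bsub>B\<^esub> Braid B (OMap F a) (OMap F b)"

text \<open>The iterated strongator \<open>(F a)\<^sup>\<otimes>\<^sup>n \<rightarrow> F (a\<^sup>\<otimes>\<^sup>n)\<close>.\<close>

fun strongator_pow ::
  "('a, 'f) smc \<Rightarrow> ('b, 'g) smc \<Rightarrow> ('a, 'f, 'b, 'g) monoidal_functor \<Rightarrow> 'a \<Rightarrow> nat \<Rightarrow> 'g" where
  "strongator_pow A B F a 0 = UStrongator F"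
| "strongator_pow A B F a (Suc 0) = Ident B (OMap F a)"
| "strongator_pow A B F a (Suc (Suc n)) =
     Strongator F (tpow A a (Suc n)) a \<cdot>\<^bsub>B\<^esub>
     (strongator_pow A B F a (Suc n) \<boxtimes>\<^bsub>B\<^esub> Ident B (OMap F a))"


section \<open>Supplies\<close>

text \<open>
  Only the binary strongators of \<open>s c\<close> are prescribed; the unit axioms then force the unit
  strongator to be the identity.
\<close>

locale prop_supply =
  P: prop_category P + C: symmetric_monoidal_category C
  for P :: "(nat, 'p) smc" and C :: "('o, 'm) smc" +
  fixes s :: "'o \<Rightarrow> (nat, 'p, 'o, 'm) monoidal_functor"
  assumes supply_functor: "c \<in> Obj C \<Longrightarrow> strong_monoidal_functor P C (s c)"
    and supply_OMap: "c \<in> Obj C \<Longrightarrow> OMap (s c) m = tpow C c m"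
    and supply_Strongator: "c \<in> Obj C \<Longrightarrow>
      Strongator (s c) m n = rebracket C (replicate m c) (replicate n c)"
    and supply_tensor: "c \<in> Obj C \<Longrightarrow> d \<in> Obj C \<Longrightarrow> \<mu> \<in> hom P m n \<Longrightarrow>
      AMap (s (c \<otimes>\<^bsub>C\<^esub> d)) \<mu> \<cdot>\<^bsub>C\<^esub> shuffle C c d m =
      shuffle C c d n \<cdot>\<^bsub>C\<^esub> (AMap (s c) \<mu> \<boxtimes>\<^bsub>C\<^esub> AMap (s d) \<mu>)"
    and supply_unit: "\<mu> \<in> hom P m n \<Longrightarrow>
      AMap (s (Unit C)) \<mu> \<cdot>\<^bsub>C\<^esub> unit_shuffle C m = unit_shuffle C n"

text \<open>
  A strong monoidal functor \<open>F : C \<rightarrow> D\<close> preserves supplies \<open>s\<close> and \<open>t\<close> of \<open>P\<close> when the iterated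
  strongators carry \<open>t (F c) \<mu>\<close> to \<open>F (s c \<mu>)\<close>.
\<close>

definition preserves_supply ::
  "(nat, 'p) smc \<Rightarrow>
   ('a, 'f) smc \<Rightarrow> ('a \<Rightarrow> (nat, 'p, 'a, 'f) monoidal_functor) \<Rightarrow>
   ('b, 'g) smc \<Rightarrow> ('b \<Rightarrow> (nat, 'p, 'b, 'g) monoidal_functor) \<Rightarrow>
   ('a, 'f, 'b, 'g) monoidal_functor \<Rightarrow> bool" where
  "preserves_supply P C s D t F \<longleftrightarrow>
     strong_monoidal_functor C D F \<and>
     (\<forall>c \<in> Obj C. \<forall>m n. \<forall>\<mu> \<in> hom P m n.
        AMap F (AMap (s c) \<mu>) \<cdot>\<^bsub>D\<^esub> strongator_pow C D F c m =
        strongator_pow C D F c n \<cdot>\<^bsub>D\<^esub> AMap (t (OMap F c)) \<mu>)"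


section \<open>Strictification\<close>

text \<open>
  An arrow \<open>L \<rightarrow> M\<close> is an arrow \<open>f : tens C L \<rightarrow> tens C M\<close> of \<open>C\<close>, stored as the triple
  \<open>(L, f, M)\<close> so that it determines its domain and codomain.
\<close>

definition strictification :: "('o, 'm) smc \<Rightarrow> ('o list, 'o list \<times> 'm \<times> 'o list) smc" where
  "strictification C = \<lparr>
     Obj = lists (Obj C),
     Arr = {(L, f, M). L \<in> lists (Obj C) \<and> M \<in> lists (Obj C) \<and> f \<in> hom C (tens C L) (tens C M)},
     Dom = (\<lambda>(L, f, M). L),
     Cod = (\<lambda>(L, f, M). M),
     Ident = (\<lambda>L. (L, Ident C (tens C L), L)),
     Comp = (\<lambda>(L', g, M') (L, f, M). (L, g \<cdot>\<^bsub>C\<^esub> f, M')),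
     Unit = [],
     TensO = (@),
     TensA = (\<lambda>(L, f, L') (M, g, M').
       (L @ M,
        rebracket C L' M' \<cdot>\<^bsub>C\<^esub> (f \<boxtimes>\<^bsub>C\<^esub> g) \<cdot>\<^bsub>C\<^esub> inv_arr C (rebracket C L M),
        L' @ M')),
     Assoc = (\<lambda>L M N. (L @ M @ N, Ident C (tens C (L @ M @ N)), L @ M @ N)),
     LUnit = (\<lambda>L. (L, Ident C (tens C L), L)),
     RUnit = (\<lambda>L. (L, Ident C (tens C L), L)),
     Braid = (\<lambda>L M.
       (L @ M,
        rebracket C M L \<cdot>\<^bsub>C\<^esub> Braid C (tens C L) (tens C M) \<cdot>\<^bsub>C\<^esub> inv_arr C (rebracket C L M),
        M @ L)) \<rparr>"

text \<open>The monoidal equivalence from the strictification to \<open>C\<close>, sending a list to its product.\<close>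

definition tens_functor ::
  "('o, 'm) smc \<Rightarrow> ('o list, 'o list \<times> 'm \<times> 'o list, 'o, 'm) monoidal_functor" where
  "tens_functor C = \<lparr>
     OMap = tens C,
     AMap = (\<lambda>(L, f, M). f),
     Strongator = rebracket C,
     UStrongator = Ident C (Unit C) \<rparr>"

end

(*
  Let F be the equivalence from the strictification to C and phi_n : (F L)^n -> F (L^n) its
  iterated strongators.  Since F is fully faithful, s' L mu is defined by
  F (s' L mu) = phi_n . s (F L) mu . inv phi_m, so preservation holds by construction and the functor
  axioms transfer from s (F L).  A supply need not be natural in c, not even along isomorphisms, so
  compatibility with tensors is not immediate: F (L @ M) and F L (x) F M are only isomorphic.  They are
  equal when M is a singleton and L is nonempty, where the tensor axiom of s applies directly; the
  general case follows by induction on M, because shuffles in a symmetric strict monoidal category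
  satisfy a strict associativity law.
*)

theory Submission
  imports Defs
begin

section \<open>Invertible arrows and coherence of rebracketing\<close>

text \<open>Preservation forces the arrow part of the lifted supply: F is faithful and the
  \<open>phi_n\<close> are invertible, so the only freedom lies in checking the supply axioms. Of
  Mac Lane coherence only fragments enter, chiefly the associativity of rebracketing,
  \<open>rebracket_assoc\<close>. It makes the strictification strict and monoidal, and it is at the
  same time the associativity axiom of F. The singleton case rests on left bracketing:
  \<open>tens C (L @ [c])\<close> and \<open>tens C L \<otimes> c\<close> are the same object when L
  is nonempty, and the strongator between them is an identity. For empty L the two objects are c and
  I \<otimes> c, so that case has to come from the unit axiom of s instead. Associativity of
  shuffles enters because the shuffle of three lists can be computed along either bracketing. The
  compatibility squares for (L @ M, [c]), (L, M) and (M, [c]) therefore paste to the square for (L,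
  M @ [c]), up to an invertible factor that cancels.\<close>

definition invertible :: "('o, 'm) smc \<Rightarrow> 'm \<Rightarrow> bool" where
  "invertible C f \<longleftrightarrow> (\<exists>g. inverse_arrows C f g)"

declare in_listsD [rule del] in_listsI [rule del]

text \<open>The axioms are typed by \<open>hom\<close>; splitting this into an arrow condition and
  two endpoint equations makes composability a matter of rewriting. The axioms are restated in that
  form below.\<close>

lemma in_hom_iff: "f \<in> hom C a b \<longleftrightarrow> f \<in> Arr C \<and> Dom C f = a \<and> Cod C f = b"
  by (auto simp: hom_def)

lemma in_isos_iff: "f \<in> isos C a b \<longleftrightarrow> invertible C f \<and> Dom C f = a \<and> Cod C f = b"
  by (auto simp: isos_def hom_def invertible_def inverse_arrows_def)

lemma invertible_Arr: "invertible C f \<Longrightarrow> f \<in> Arr C"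
  by (auto simp: invertible_def inverse_arrows_def)

section \<open>Calculus of invertible arrows\<close>

context category
begin

declare Dom_Obj [simp] Cod_Obj [simp]

lemma Ident_simps [simp]:
  assumes "a \<in> Obj C"
  shows "Ident C a \<in> Arr C" "Dom C (Ident C a) = a" "Cod C (Ident C a) = a"
  using Ident_hom[OF assms] by (auto simp: in_hom_iff)

lemma Comp_simps [simp]:
  assumes "f \<in> Arr C" "g \<in> Arr C" "Dom C g = Cod C f"
  shows "g \<cdot> f \<in> Arr C" "Dom C (g \<cdot> f) = Dom C f" "Cod C (g \<cdot> f) = Cod C g"
  using Comp_hom[of f "Dom C f" "Cod C f" g "Cod C g"] assms by (auto simp: in_hom_iff)

lemma Comp_Ident_simps [simp]:
  "f \<in> Arr C \<Longrightarrow> Cod C f = b \<Longrightarrow> Ident C b \<cdot> f = f"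
  "f \<in> Arr C \<Longrightarrow> Dom C f = a \<Longrightarrow> f \<cdot> Ident C a = f"
  using Comp_Ident_left Comp_Ident_right by (auto simp: in_hom_iff)

lemma Comp_assoc_right [simp]:
  "f \<in> Arr C \<Longrightarrow> g \<in> Arr C \<Longrightarrow> h \<in> Arr C \<Longrightarrow> Dom C g = Cod C f \<Longrightarrow> Dom C h = Cod C g \<Longrightarrow>
    (h \<cdot> g) \<cdot> f = h \<cdot> (g \<cdot> f)"
  using Comp_assoc[of f "Dom C f" "Cod C f" g "Cod C g" h "Cod C h"] by (auto simp: in_hom_iff)

lemma inverse_arrows_unique:
  assumes "inverse_arrows C f g" "inverse_arrows C f h"
  shows "g = h"
proof -
  have "g = g \<cdot> (f \<cdot> h)" using assms by (auto simp: inverse_arrows_def in_hom_iff)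
  also have "\<dots> = (g \<cdot> f) \<cdot> h" using assms by (subst Comp_assoc_right) (auto simp: inverse_arrows_def in_hom_iff)
  also have "\<dots> = h" using assms by (auto simp: inverse_arrows_def in_hom_iff)
  finally show ?thesis .
qed

lemma inv_arr_eqI: "inverse_arrows C f g \<Longrightarrow> inv_arr C f = g"
  unfolding inv_arr_def by (rule the_equality) (auto intro: inverse_arrows_unique)

lemma inverse_arrows_inv_arr: "invertible C f \<Longrightarrow> inverse_arrows C f (inv_arr C f)"
  using inv_arr_eqI by (auto simp: invertible_def)

lemma inv_arr_simps [simp]:
  assumes "invertible C f"
  shows "inv_arr C f \<in> Arr C" "Dom C (inv_arr C f) = Cod C f" "Cod C (inv_arr C f) = Dom C f"
    "inv_arr C f \<cdot> f = Ident C (Dom C f)" "f \<cdot> inv_arr C f = Ident C (Cod C f)"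
  using inverse_arrows_inv_arr[OF assms] by (auto simp: inverse_arrows_def in_hom_iff)

lemma inv_arr_cancel [simp]:
  assumes "invertible C f" "h \<in> Arr C"
  shows "Cod C h = Dom C f \<Longrightarrow> inv_arr C f \<cdot> (f \<cdot> h) = h"
    and "Cod C h = Cod C f \<Longrightarrow> f \<cdot> (inv_arr C f \<cdot> h) = h"
  using assms invertible_Arr[OF assms(1)] by (simp_all flip: Comp_assoc_right)

lemma inverse_arrows_Ident: "a \<in> Obj C \<Longrightarrow> inverse_arrows C (Ident C a) (Ident C a)"
  by (simp add: inverse_arrows_def in_hom_iff)

lemma inverse_arrows_sym: "inverse_arrows C f g \<Longrightarrow> inverse_arrows C g f"
  by (auto simp: inverse_arrows_def in_hom_iff)

lemma inverse_arrows_Comp: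
  assumes "invertible C f" "invertible C g" "Dom C g = Cod C f"
  shows "inverse_arrows C (g \<cdot> f) (inv_arr C f \<cdot> inv_arr C g)"
  using assms assms(1,2)[THEN invertible_Arr] by (simp add: inverse_arrows_def in_hom_iff)

lemma invertible_Ident [simp]: "a \<in> Obj C \<Longrightarrow> invertible C (Ident C a)"
  and inv_arr_Ident [simp]: "a \<in> Obj C \<Longrightarrow> inv_arr C (Ident C a) = Ident C a"
  using inverse_arrows_Ident inv_arr_eqI by (auto simp: invertible_def)

lemma invertible_inv_arr [simp]: "invertible C f \<Longrightarrow> invertible C (inv_arr C f)"
  and inv_arr_inv_arr [simp]: "invertible C f \<Longrightarrow> inv_arr C (inv_arr C f) = f"
  using inverse_arrows_sym[OF inverse_arrows_inv_arr] inv_arr_eqI by (auto simp: invertible_def)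

lemma invertible_Comp [simp]:
    "invertible C f \<Longrightarrow> invertible C g \<Longrightarrow> Dom C g = Cod C f \<Longrightarrow> invertible C (g \<cdot> f)"
  and inv_arr_Comp:
    "invertible C f \<Longrightarrow> invertible C g \<Longrightarrow> Dom C g = Cod C f \<Longrightarrow>
      inv_arr C (g \<cdot> f) = inv_arr C f \<cdot> inv_arr C g"
  using inverse_arrows_Comp[of f g] inv_arr_eqI by (auto simp: invertible_def)

text \<open>Most diagrams below are compared after precomposition with an invertible coherence map;
  this lemma removes that map at the end.\<close>

lemma invertible_cancel_right:
  assumes "f \<cdot> e = g \<cdot> e" "invertible C e" "f \<in> Arr C" "g \<in> Arr C" "Dom C f = Cod C e" "Dom C g = Cod C e"
  shows "f = g"
proof -
  have "(f \<cdot> e) \<cdot> inv_arr C e = (g \<cdot> e) \<cdot> inv_arr C e" by (simp only: assms(1))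
  then show ?thesis using assms(2-) invertible_Arr[OF assms(2)] by simp
qed

lemma invertible_cancel_left:
  assumes "e \<cdot> f = e \<cdot> g" "invertible C e" "f \<in> Arr C" "g \<in> Arr C" "Dom C e = Cod C f" "Dom C e = Cod C g"
  shows "f = g"
proof -
  have "inv_arr C e \<cdot> (e \<cdot> f) = inv_arr C e \<cdot> (e \<cdot> g)" by (simp only: assms(1))
  then show ?thesis using assms(2-) by simp
qed

text \<open>In composites normalised to the right, the two arrows of a commuting square are in
  general not a subterm when more arrows precede them. This form applies the square at the head of
  such a composite.\<close>

lemma Comp_eq_extend:
  assumes "g \<cdot> f = g' \<cdot> f'"
    "f \<in> Arr C" "g \<in> Arr C" "Dom C g = Cod C f" "f' \<in> Arr C" "g' \<in> Arr C" "Dom C g' = Cod C f'"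
    "h \<in> Arr C" "Cod C h = Dom C f"
  shows "g \<cdot> (f \<cdot> h) = g' \<cdot> (f' \<cdot> h)"
proof -
  have "Dom C f' = Dom C f" using assms Comp_simps(2) by metis
  then have "(g \<cdot> f) \<cdot> h = g \<cdot> (f \<cdot> h)" "(g' \<cdot> f') \<cdot> h = g' \<cdot> (f' \<cdot> h)" using assms(2-) by simp_all
  then show ?thesis using assms(1) by simp
qed

end

section \<open>Unit coherence and associativity of rebracketing\<close>

context monoidal_category
begin

declare Unit_Obj [simp] TensO_Obj [simp] TensA_Ident [simp]

lemma TensA_simps [simp]:
  assumes "f \<in> Arr C" "g \<in> Arr C"
  shows "f \<boxtimes> g \<in> Arr C" "Dom C (f \<boxtimes> g) = Dom C f \<otimes> Dom C g" "Cod C (f \<boxtimes> g) = Cod C f \<otimes> Cod C g"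
  using TensA_hom[of f "Dom C f" "Cod C f" g "Dom C g" "Cod C g"] assms by (auto simp: in_hom_iff)

lemma TensA_Comp [simp]:
  "f \<in> Arr C \<Longrightarrow> g \<in> Arr C \<Longrightarrow> f' \<in> Arr C \<Longrightarrow> g' \<in> Arr C \<Longrightarrow>
    Dom C g = Cod C f \<Longrightarrow> Dom C g' = Cod C f' \<Longrightarrow> (g \<boxtimes> g') \<cdot> (f \<boxtimes> f') = (g \<cdot> f) \<boxtimes> (g' \<cdot> f')"
  using interchange[of f "Dom C f" "Cod C f" g "Cod C g" f' "Dom C f'" "Cod C f'" g' "Cod C g'"]
  by (auto simp: in_hom_iff)

lemma TensA_Comp_assoc [simp]:
  "f \<in> Arr C \<Longrightarrow> g \<in> Arr C \<Longrightarrow> f' \<in> Arr C \<Longrightarrow> g' \<in> Arr C \<Longrightarrow> h \<in> Arr C \<Longrightarrow>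
    Dom C g = Cod C f \<Longrightarrow> Dom C g' = Cod C f' \<Longrightarrow> Cod C h = Dom C f \<otimes> Dom C f' \<Longrightarrow>
    (g \<boxtimes> g') \<cdot> ((f \<boxtimes> f') \<cdot> h) = ((g \<cdot> f) \<boxtimes> (g' \<cdot> f')) \<cdot> h"
  by (simp flip: Comp_assoc_right)

lemma inverse_arrows_TensA:
  assumes "invertible C f" "invertible C g"
  shows "inverse_arrows C (f \<boxtimes> g) (inv_arr C f \<boxtimes> inv_arr C g)"
  using assms assms[THEN invertible_Arr] by (simp add: inverse_arrows_def in_hom_iff)

lemma invertible_TensA [simp]: "invertible C f \<Longrightarrow> invertible C g \<Longrightarrow> invertible C (f \<boxtimes> g)"
  and inv_arr_TensA [simp]:
    "invertible C f \<Longrightarrow> invertible C g \<Longrightarrow> inv_arr C (f \<boxtimes> g) = inv_arr C f \<boxtimes> inv_arr C g"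
  using inverse_arrows_TensA[of f g] inv_arr_eqI by (auto simp: invertible_def)

lemma Assoc_simps [simp]:
  assumes "a \<in> Obj C" "b \<in> Obj C" "c \<in> Obj C"
  shows "invertible C (Assoc C a b c)" "Assoc C a b c \<in> Arr C"
    "Dom C (Assoc C a b c) = (a \<otimes> b) \<otimes> c" "Cod C (Assoc C a b c) = a \<otimes> (b \<otimes> c)"
  using Assoc_iso[OF assms] invertible_Arr by (auto simp: in_isos_iff)

lemma LUnit_simps [simp]:
  assumes "a \<in> Obj C"
  shows "invertible C (LUnit C a)" "LUnit C a \<in> Arr C"
    "Dom C (LUnit C a) = Unit C \<otimes> a" "Cod C (LUnit C a) = a"
  using LUnit_iso[OF assms] invertible_Arr by (auto simp: in_isos_iff)

lemma RUnit_simps [simp]: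
  assumes "a \<in> Obj C"
  shows "invertible C (RUnit C a)" "RUnit C a \<in> Arr C"
    "Dom C (RUnit C a) = a \<otimes> Unit C" "Cod C (RUnit C a) = a"
  using RUnit_iso[OF assms] invertible_Arr by (auto simp: in_isos_iff)

lemma Assoc_naturality:
  "f \<in> Arr C \<Longrightarrow> g \<in> Arr C \<Longrightarrow> h \<in> Arr C \<Longrightarrow>
    Assoc C (Cod C f) (Cod C g) (Cod C h) \<cdot> ((f \<boxtimes> g) \<boxtimes> h) =
    (f \<boxtimes> (g \<boxtimes> h)) \<cdot> Assoc C (Dom C f) (Dom C g) (Dom C h)"
  by (rule Assoc_natural) (auto simp: in_hom_iff)

lemma inv_Assoc_naturality:
  assumes "f \<in> Arr C" "g \<in> Arr C" "h \<in> Arr C"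
  shows "inv_arr C (Assoc C (Cod C f) (Cod C g) (Cod C h)) \<cdot> (f \<boxtimes> (g \<boxtimes> h)) =
    ((f \<boxtimes> g) \<boxtimes> h) \<cdot> inv_arr C (Assoc C (Dom C f) (Dom C g) (Dom C h))"
proof -
  let ?\<alpha> = "Assoc C (Cod C f) (Cod C g) (Cod C h)" and ?\<beta> = "Assoc C (Dom C f) (Dom C g) (Dom C h)"
  have "inv_arr C ?\<alpha> \<cdot> (f \<boxtimes> (g \<boxtimes> h)) = inv_arr C ?\<alpha> \<cdot> (((f \<boxtimes> (g \<boxtimes> h)) \<cdot> ?\<beta>) \<cdot> inv_arr C ?\<beta>)"
    using assms by simp
  also have "\<dots> = ((f \<boxtimes> g) \<boxtimes> h) \<cdot> inv_arr C ?\<beta>"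
    unfolding Assoc_naturality[OF assms, symmetric] using assms by simp
  finally show ?thesis .
qed

lemma LUnit_naturality:
  "f \<in> Arr C \<Longrightarrow> LUnit C (Cod C f) \<cdot> (Ident C (Unit C) \<boxtimes> f) = f \<cdot> LUnit C (Dom C f)"
  by (rule LUnit_natural) (auto simp: in_hom_iff)

lemma RUnit_naturality:
  "f \<in> Arr C \<Longrightarrow> RUnit C (Cod C f) \<cdot> (f \<boxtimes> Ident C (Unit C)) = f \<cdot> RUnit C (Dom C f)"
  by (rule RUnit_natural) (auto simp: in_hom_iff)

text \<open>The left unitor is a natural isomorphism from I \<otimes> - to the identity functor, so
  I \<otimes> - is faithful.\<close>

lemma TensA_Unit_left_cancel:
  assumes "Ident C (Unit C) \<boxtimes> f = Ident C (Unit C) \<boxtimes> g" "f \<in> Arr C" "g \<in> Arr C"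
    "Dom C f = Dom C g" "Cod C f = Cod C g"
  shows "f = g"
proof -
  have "f \<cdot> LUnit C (Dom C f) = g \<cdot> LUnit C (Dom C f)"
    using assms LUnit_naturality[of f] LUnit_naturality[of g] by simp
  then show ?thesis by (rule invertible_cancel_right) (use assms in simp_all)
qed

lemma TensA_Unit_right_cancel:
  assumes "f \<boxtimes> Ident C (Unit C) = g \<boxtimes> Ident C (Unit C)" "f \<in> Arr C" "g \<in> Arr C"
    "Dom C f = Dom C g" "Cod C f = Cod C g"
  shows "f = g"
proof -
  have "f \<cdot> RUnit C (Dom C f) = g \<cdot> RUnit C (Dom C f)"
    using assms RUnit_naturality[of f] RUnit_naturality[of g] by simp
  then show ?thesis by (rule invertible_cancel_right) (use assms in simp_all)
qed

text \<open>Kelly's argument that this unit law follows from pentagon and triangle. After tensoring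
  with I on the left, the pentagon for I, I, a, b applies; two triangles and naturality of the
  associator do the rest.\<close>

lemma LUnit_TensO:
  assumes [simp]: "a \<in> Obj C" "b \<in> Obj C"
  shows "LUnit C (a \<otimes> b) \<cdot> Assoc C (Unit C) a b = LUnit C a \<boxtimes> Ident C b"
proof (rule TensA_Unit_left_cancel)
  let ?I = "Unit C"
  let ?i = "Ident C ?I"
  \<comment> \<open>The part of the pentagon that precedes
    \<open>?i \<boxtimes> Assoc C ?I a b\<close>; it is invertible and cancels at the end.\<close>
  let ?e = "Assoc C ?I (?I \<otimes> a) b \<cdot> (Assoc C ?I ?I a \<boxtimes> Ident C b)"
  have "(?i \<boxtimes> (LUnit C (a \<otimes> b) \<cdot> Assoc C ?I a b)) \<cdot> ?e =
      (?i \<boxtimes> LUnit C (a \<otimes> b)) \<cdot> ((?i \<boxtimes> Assoc C ?I a b) \<cdot> ?e)"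
    by simp
  also have "\<dots> = (?i \<boxtimes> LUnit C (a \<otimes> b)) \<cdot> (Assoc C ?I ?I (a \<otimes> b) \<cdot> Assoc C (?I \<otimes> ?I) a b)"
    using pentagon[of ?I ?I a b] by simp
  also have "\<dots> = ((?i \<boxtimes> LUnit C (a \<otimes> b)) \<cdot> Assoc C ?I ?I (a \<otimes> b)) \<cdot> Assoc C (?I \<otimes> ?I) a b"
    by (rule Comp_assoc_right[symmetric]) simp_all
  also have "\<dots> = (RUnit C ?I \<boxtimes> (Ident C a \<boxtimes> Ident C b)) \<cdot> Assoc C (?I \<otimes> ?I) a b"
    using triangle[of ?I "a \<otimes> b"] by simp
  also have "\<dots> = Assoc C ?I a b \<cdot> ((RUnit C ?I \<boxtimes> Ident C a) \<boxtimes> Ident C b)"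
    using Assoc_naturality[of "RUnit C ?I" "Ident C a" "Ident C b"] by (simp del: TensA_Ident)
  also have "\<dots> = Assoc C ?I a b \<cdot> (((?i \<boxtimes> LUnit C a) \<boxtimes> Ident C b) \<cdot> (Assoc C ?I ?I a \<boxtimes> Ident C b))"
    using triangle[of ?I a] by simp
  also have "\<dots> = (?i \<boxtimes> (LUnit C a \<boxtimes> Ident C b)) \<cdot> ?e"
    using Assoc_naturality[of ?i "LUnit C a" "Ident C b"]
    by (intro Comp_eq_extend) simp_all
  finally show "?i \<boxtimes> (LUnit C (a \<otimes> b) \<cdot> Assoc C ?I a b) = ?i \<boxtimes> (LUnit C a \<boxtimes> Ident C b)"
    by (rule invertible_cancel_right) simp_all
qed simp_all

text \<open>Mirror image of the previous law: tensor with I on the right and use the pentagon for a,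
  b, I, I.\<close>

lemma RUnit_TensO:
  assumes [simp]: "a \<in> Obj C" "b \<in> Obj C"
  shows "(Ident C a \<boxtimes> RUnit C b) \<cdot> Assoc C a b (Unit C) = RUnit C (a \<otimes> b)"
proof (rule TensA_Unit_right_cancel)
  let ?I = "Unit C"
  let ?i = "Ident C ?I"
  let ?\<alpha> = "Assoc C a b ?I"
  have "Assoc C a b ?I \<cdot> (((Ident C a \<boxtimes> RUnit C b) \<cdot> ?\<alpha>) \<boxtimes> ?i) =
      Assoc C a b ?I \<cdot> (((Ident C a \<boxtimes> RUnit C b) \<boxtimes> ?i) \<cdot> (?\<alpha> \<boxtimes> ?i))"
    by simp
  also have "\<dots> = (Ident C a \<boxtimes> (RUnit C b \<boxtimes> ?i)) \<cdot> (Assoc C a (b \<otimes> ?I) ?I \<cdot> (?\<alpha> \<boxtimes> ?i))"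
    using Assoc_naturality[of "Ident C a" "RUnit C b" ?i] by (intro Comp_eq_extend) simp_all
  also have "\<dots> = (Ident C a \<boxtimes> (Ident C b \<boxtimes> LUnit C ?I)) \<cdot>
      ((Ident C a \<boxtimes> Assoc C b ?I ?I) \<cdot> (Assoc C a (b \<otimes> ?I) ?I \<cdot> (?\<alpha> \<boxtimes> ?i)))"
    using triangle[of b ?I] by simp
  also have "\<dots> = (Ident C a \<boxtimes> (Ident C b \<boxtimes> LUnit C ?I)) \<cdot> (Assoc C a b (?I \<otimes> ?I) \<cdot> Assoc C (a \<otimes> b) ?I ?I)"
    using pentagon[of a b ?I ?I] by simp
  also have "\<dots> = Assoc C a b ?I \<cdot> (((Ident C a \<boxtimes> Ident C b) \<boxtimes> LUnit C ?I) \<cdot> Assoc C (a \<otimes> b) ?I ?I)"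
    using Assoc_naturality[of "Ident C a" "Ident C b" "LUnit C ?I"] by (intro Comp_eq_extend) simp_all
  also have "\<dots> = Assoc C a b ?I \<cdot> (RUnit C (a \<otimes> b) \<boxtimes> ?i)"
    using triangle[of "a \<otimes> b" ?I] by simp
  finally show "((Ident C a \<boxtimes> RUnit C b) \<cdot> ?\<alpha>) \<boxtimes> ?i = RUnit C (a \<otimes> b) \<boxtimes> ?i"
    by (rule invertible_cancel_left) simp_all
qed simp_all

text \<open>Naturality of the left unitor at its own component at I identifies
  \<open>Ident C I \<boxtimes> LUnit C I\<close> with \<open>LUnit C (I \<otimes> I)\<close>, where
  I is the unit. The triangle and \<open>LUnit_TensO\<close> then evaluate the same composite in two
  ways.\<close>

lemma LUnit_Unit: "LUnit C (Unit C) = RUnit C (Unit C)"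
proof (rule TensA_Unit_right_cancel)
  let ?I = "Unit C"
  have "LUnit C ?I \<cdot> (Ident C ?I \<boxtimes> LUnit C ?I) = LUnit C ?I \<cdot> LUnit C (?I \<otimes> ?I)"
    using LUnit_naturality[of "LUnit C ?I"] by simp
  then have "Ident C ?I \<boxtimes> LUnit C ?I = LUnit C (?I \<otimes> ?I)"
    by (rule invertible_cancel_left) simp_all
  then show "LUnit C ?I \<boxtimes> Ident C ?I = RUnit C ?I \<boxtimes> Ident C ?I"
    using triangle[of ?I ?I] LUnit_TensO[of ?I ?I] by simp
qed simp_all

lemma tens_Obj [simp]: "L \<in> lists (Obj C) \<Longrightarrow> tens C L \<in> Obj C"
proof (induction L rule: rev_induct)
  case (snoc c L)
  then show ?case by (cases "L = []") auto
qed simp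

lemma tpow_Obj [simp]: "c \<in> Obj C \<Longrightarrow> tpow C c n \<in> Obj C"
  by (simp add: tpow_def in_lists_conv_set)

lemma rebracket_isos:
  "L \<in> lists (Obj C) \<Longrightarrow> M \<in> lists (Obj C) \<Longrightarrow>
    rebracket C L M \<in> isos C (tens C L \<otimes> tens C M) (tens C (L @ M))"
proof (induction M rule: rev_induct)
  case Nil
  then show ?case by (simp add: in_isos_iff rebracket_simps)
next
  case (snoc c M)
  show ?case
  proof (cases "L = [] \<or> M = []")
    case True
    then show ?thesis
      using snoc.prems by (cases "L = []") (auto simp: in_isos_iff rebracket_simps)
  next
    case False
    then show ?thesis
      using snoc tens_simps(3)[of "L @ M" C c]
      by (auto simp: in_isos_iff rebracket_simps invertible_Arr simp flip: append_assoc)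
  qed
qed

lemma rebracket_type [simp]:
  assumes "L \<in> lists (Obj C)" "M \<in> lists (Obj C)"
  shows "invertible C (rebracket C L M)" "rebracket C L M \<in> Arr C"
    "Dom C (rebracket C L M) = tens C L \<otimes> tens C M" "Cod C (rebracket C L M) = tens C (L @ M)"
  using rebracket_isos[OF assms] invertible_Arr by (auto simp: in_isos_iff)

text \<open>The recursion tests the right list for emptiness before the left one, so two empty lists
  give a right unitor. Agreement with the left unitor is \<open>LUnit_Unit\<close>.\<close>

lemma rebracket_Nil_left: "M \<in> lists (Obj C) \<Longrightarrow> rebracket C [] M = LUnit C (tens C M)"
  by (cases "M = []") (simp_all add: rebracket_simps LUnit_Unit)

text \<open>The central instance of coherence: both ways of merging three products agree. Empty
  lists are absorbed by unit laws; otherwise the last list grows on the right, where the recursion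
  of \<open>rebracket\<close> adds one associator and the pentagon compares the results.\<close>

lemma rebracket_assoc:
  assumes [simp]: "L \<in> lists (Obj C)" "M \<in> lists (Obj C)" and "N \<in> lists (Obj C)"
  shows "rebracket C (L @ M) N \<cdot> (rebracket C L M \<boxtimes> Ident C (tens C N)) =
    rebracket C L (M @ N) \<cdot> (Ident C (tens C L) \<boxtimes> rebracket C M N) \<cdot>
      Assoc C (tens C L) (tens C M) (tens C N)"
proof -
  let ?l = "tens C L" and ?m = "tens C M"
  \<comment> \<open>An empty N calls for \<open>RUnit_TensO\<close>, an empty M for the triangle, an
    empty L for \<open>LUnit_TensO\<close>.\<close>
  consider "N = []" | "N \<noteq> []" "M = []" | "N \<noteq> []" "L = []" | "N \<noteq> []" "L \<noteq> []" "M \<noteq> []"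
    by blast
  then show ?thesis
  proof cases
    case 1
    then show ?thesis
      using RUnit_naturality[of "rebracket C L M"] by (simp add: rebracket_simps RUnit_TensO)
  next
    case 2
    then show ?thesis
      using assms(3) triangle[of ?l "tens C N"] by (simp add: rebracket_simps rebracket_Nil_left)
  next
    case 3
    have "rebracket C M N \<cdot> (LUnit C ?m \<boxtimes> Ident C (tens C N)) =
        rebracket C M N \<cdot> (LUnit C (?m \<otimes> tens C N) \<cdot> Assoc C (Unit C) ?m (tens C N))"
      using assms(3) LUnit_TensO[of ?m "tens C N"] by simp
    also have "\<dots> = LUnit C (tens C (M @ N)) \<cdot> ((Ident C (Unit C) \<boxtimes> rebracket C M N) \<cdot>
        Assoc C (Unit C) ?m (tens C N))"
      using assms(3) LUnit_naturality[of "rebracket C M N"] by (intro Comp_eq_extend) simp_all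
    finally show ?thesis
      using 3 assms(3) by (simp add: rebracket_Nil_left)
  next
    case 4
    from 4(1) assms(3) show ?thesis
    proof (induction N rule: rev_induct)
      case Nil
      then show ?case by simp
    next
      case (snoc c N)
      then have [simp]: "c \<in> Obj C" "N \<in> lists (Obj C)" by auto
      let ?n = "tens C N" and ?c = "Ident C c"
      show ?case
      \<comment> \<open>Appending a single object to the empty list makes the claim the recursive
        clause for \<open>rebracket C L (M @ [c])\<close>, since the other two rebracketings are
        identities.\<close>
      proof (cases "N = []")
        case True
        then show ?thesis using 4 tens_simps(3)[of "L @ M" C c] by (simp add: rebracket_simps)
      next
        case False
        let ?A = "Assoc C ?l ?m ?n"
        have r: "rebracket C (L @ M) N \<cdot> (rebracket C L M \<boxtimes> Ident C ?n) =
            rebracket C L (M @ N) \<cdot> (Ident C ?l \<boxtimes> rebracket C M N) \<cdot> ?A"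
          using snoc.IH False by simp
        have LMN: "tens C (L @ M @ N @ [c]) = tens C (L @ M @ N) \<otimes> c"
          "tens C (M @ N @ [c]) = tens C (M @ N) \<otimes> c"
          using 4 tens_simps(3)[of "L @ M @ N" C c] tens_simps(3)[of "M @ N" C c] by simp_all
        have "rebracket C (L @ M) (N @ [c]) \<cdot> (rebracket C L M \<boxtimes> Ident C (tens C (N @ [c]))) =
            (rebracket C (L @ M) N \<boxtimes> ?c) \<cdot>
              (inv_arr C (Assoc C (tens C (L @ M)) ?n c) \<cdot> (rebracket C L M \<boxtimes> (Ident C ?n \<boxtimes> ?c)))"
          using 4 False by (simp add: rebracket_simps)
        also have "\<dots> = (rebracket C (L @ M) N \<boxtimes> ?c) \<cdot>
              (((rebracket C L M \<boxtimes> Ident C ?n) \<boxtimes> ?c) \<cdot> inv_arr C (Assoc C (?l \<otimes> ?m) ?n c))"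
          using inv_Assoc_naturality[of "rebracket C L M" "Ident C ?n" ?c] by (simp del: TensA_Ident)
        also have "\<dots> = (rebracket C L (M @ N) \<boxtimes> ?c) \<cdot> (((Ident C ?l \<boxtimes> rebracket C M N) \<boxtimes> ?c) \<cdot>
              ((?A \<boxtimes> ?c) \<cdot> inv_arr C (Assoc C (?l \<otimes> ?m) ?n c)))"
          using r by simp
        \<comment> \<open>The pentagon solved for a form with two inverse associators; it is
          verified by composing with the associators that they invert.\<close>
        also have "(?A \<boxtimes> ?c) \<cdot> inv_arr C (Assoc C (?l \<otimes> ?m) ?n c) =
            inv_arr C (Assoc C ?l (?m \<otimes> ?n) c) \<cdot> ((Ident C ?l \<boxtimes> inv_arr C (Assoc C ?m ?n c)) \<cdot>
              Assoc C ?l ?m (?n \<otimes> c))" (is "?u = ?v")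
        proof -
          have "(Ident C ?l \<boxtimes> Assoc C ?m ?n c) \<cdot> (Assoc C ?l (?m \<otimes> ?n) c \<cdot> ?u) =
              ((Ident C ?l \<boxtimes> Assoc C ?m ?n c) \<cdot> (Assoc C ?l (?m \<otimes> ?n) c \<cdot> (?A \<boxtimes> ?c))) \<cdot>
                inv_arr C (Assoc C (?l \<otimes> ?m) ?n c)"
            by simp
          also have "\<dots> = (Assoc C ?l ?m (?n \<otimes> c) \<cdot> Assoc C (?l \<otimes> ?m) ?n c) \<cdot>
              inv_arr C (Assoc C (?l \<otimes> ?m) ?n c)"
            by (subst pentagon) simp_all
          also have "\<dots> = (Ident C ?l \<boxtimes> Assoc C ?m ?n c) \<cdot> (Assoc C ?l (?m \<otimes> ?n) c \<cdot> ?v)"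
            by simp
          finally have "Assoc C ?l (?m \<otimes> ?n) c \<cdot> ?u = Assoc C ?l (?m \<otimes> ?n) c \<cdot> ?v"
            by (rule invertible_cancel_left) simp_all
          then show ?thesis by (rule invertible_cancel_left) simp_all
        qed
        also have "((Ident C ?l \<boxtimes> rebracket C M N) \<boxtimes> ?c) \<cdot> ?v =
            inv_arr C (Assoc C ?l (tens C (M @ N)) c) \<cdot> ((Ident C ?l \<boxtimes> (rebracket C M N \<boxtimes> ?c)) \<cdot>
              ((Ident C ?l \<boxtimes> inv_arr C (Assoc C ?m ?n c)) \<cdot> Assoc C ?l ?m (?n \<otimes> c)))"
          using inv_Assoc_naturality[of "Ident C ?l" "rebracket C M N" ?c]
          by (intro Comp_eq_extend) simp_all
        finally show ?thesis
          using 4 False rebracket_simps(4)[of L "M @ N" C c] rebracket_simps(4)[of M N C c]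
          by (simp add: LMN)
      qed
    qed
  qed
qed

end

section \<open>Shuffles\<close>

context symmetric_monoidal_category
begin

lemma Braid_simps [simp]:
  assumes "a \<in> Obj C" "b \<in> Obj C"
  shows "Braid C a b \<in> Arr C" "Dom C (Braid C a b) = a \<otimes> b" "Cod C (Braid C a b) = b \<otimes> a"
    "invertible C (Braid C a b)" "inv_arr C (Braid C a b) = Braid C b a"
proof -
  have "inverse_arrows C (Braid C a b) (Braid C b a)"
    using assms Braid_hom[OF assms] Braid_hom[OF assms(2,1)] Braid_symmetric[OF assms]
      Braid_symmetric[OF assms(2,1)]
    by (simp add: inverse_arrows_def in_hom_iff)
  then show "invertible C (Braid C a b)" "inv_arr C (Braid C a b) = Braid C b a"
    using inv_arr_eqI by (auto simp: invertible_def)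
qed (use Braid_hom[OF assms] in \<open>auto simp: in_hom_iff\<close>)

lemma Braid_naturality:
  "f \<in> Arr C \<Longrightarrow> g \<in> Arr C \<Longrightarrow>
    Braid C (Cod C f) (Cod C g) \<cdot> (f \<boxtimes> g) = (g \<boxtimes> f) \<cdot> Braid C (Dom C f) (Dom C g)"
  by (rule Braid_natural) (auto simp: in_hom_iff)

declare Braid_symmetric [simp]

lemma Braid_cancel [simp]:
  "a \<in> Obj C \<Longrightarrow> b \<in> Obj C \<Longrightarrow> h \<in> Arr C \<Longrightarrow> Cod C h = a \<otimes> b \<Longrightarrow>
    Braid C b a \<cdot> (Braid C a b \<cdot> h) = h"
  by (simp flip: Comp_assoc_right)

lemma middle_swap_simps [simp]:
  assumes "a \<in> Obj C" "b \<in> Obj C" "c \<in> Obj C" "d \<in> Obj C"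
  shows "middle_swap C a b c d \<in> Arr C"
    "Dom C (middle_swap C a b c d) = (a \<otimes> b) \<otimes> (c \<otimes> d)"
    "Cod C (middle_swap C a b c d) = (a \<otimes> c) \<otimes> (b \<otimes> d)"
    "invertible C (middle_swap C a b c d)"
  using assms by (simp_all add: middle_swap_def)

text \<open>Every factor of \<open>middle_swap\<close> is natural, so the four arrows slide through
  the associators and the braiding one factor at a time.\<close>

lemma middle_swap_naturality:
  assumes [simp]: "f \<in> Arr C" "g \<in> Arr C" "h \<in> Arr C" "k \<in> Arr C"
  shows "middle_swap C (Cod C f) (Cod C g) (Cod C h) (Cod C k) \<cdot> ((f \<boxtimes> g) \<boxtimes> (h \<boxtimes> k)) =
    ((f \<boxtimes> h) \<boxtimes> (g \<boxtimes> k)) \<cdot> middle_swap C (Dom C f) (Dom C g) (Dom C h) (Dom C k)"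
proof -
  define a b c d where "a = Dom C f" "b = Dom C g" "c = Dom C h" "d = Dom C k"
  define a' b' c' d' where "a' = Cod C f" "b' = Cod C g" "c' = Cod C h" "d' = Cod C k"
  note defs [simp] = a_b_c_d_def[symmetric] a'_b'_c'_d'_def[symmetric]
  have [simp]: "a \<in> Obj C" "b \<in> Obj C" "c \<in> Obj C" "d \<in> Obj C"
    "a' \<in> Obj C" "b' \<in> Obj C" "c' \<in> Obj C" "d' \<in> Obj C"
    by (simp_all add: a_b_c_d_def a'_b'_c'_d'_def del: defs)
  have "middle_swap C a' b' c' d' \<cdot> ((f \<boxtimes> g) \<boxtimes> (h \<boxtimes> k)) =
      inv_arr C (Assoc C a' c' (b' \<otimes> d')) \<cdot>
      ((Ident C a' \<boxtimes> (Assoc C c' b' d' \<cdot> (Braid C b' c' \<boxtimes> Ident C d') \<cdot> inv_arr C (Assoc C b' c' d'))) \<cdot>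
      (Assoc C a' b' (c' \<otimes> d') \<cdot> ((f \<boxtimes> g) \<boxtimes> (h \<boxtimes> k))))"
    by (simp add: middle_swap_def)
  also have "Assoc C a' b' (c' \<otimes> d') \<cdot> ((f \<boxtimes> g) \<boxtimes> (h \<boxtimes> k)) =
      (f \<boxtimes> (g \<boxtimes> (h \<boxtimes> k))) \<cdot> Assoc C a b (c \<otimes> d)"
    using Assoc_naturality[of f g "h \<boxtimes> k"] by simp
  also have "(Ident C a' \<boxtimes> (Assoc C c' b' d' \<cdot> (Braid C b' c' \<boxtimes> Ident C d') \<cdot> inv_arr C (Assoc C b' c' d'))) \<cdot>
        ((f \<boxtimes> (g \<boxtimes> (h \<boxtimes> k))) \<cdot> Assoc C a b (c \<otimes> d)) =
      (f \<boxtimes> (Assoc C c' b' d' \<cdot> ((Braid C b' c' \<boxtimes> Ident C d') \<cdot> (inv_arr C (Assoc C b' c' d') \<cdot>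
        (g \<boxtimes> (h \<boxtimes> k)))))) \<cdot> Assoc C a b (c \<otimes> d)"
    by simp
  also have "inv_arr C (Assoc C b' c' d') \<cdot> (g \<boxtimes> (h \<boxtimes> k)) =
      ((g \<boxtimes> h) \<boxtimes> k) \<cdot> inv_arr C (Assoc C b c d)"
    using inv_Assoc_naturality[of g h k] by simp
  also have "(Braid C b' c' \<boxtimes> Ident C d') \<cdot> (((g \<boxtimes> h) \<boxtimes> k) \<cdot> inv_arr C (Assoc C b c d)) =
      ((h \<boxtimes> g) \<boxtimes> k) \<cdot> ((Braid C b c \<boxtimes> Ident C d) \<cdot> inv_arr C (Assoc C b c d))"
    using Braid_naturality[of g h] by simp
  also have "Assoc C c' b' d' \<cdot> \<dots> = (h \<boxtimes> (g \<boxtimes> k)) \<cdot>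
      (Assoc C c b d \<cdot> ((Braid C b c \<boxtimes> Ident C d) \<cdot> inv_arr C (Assoc C b c d)))"
    using Assoc_naturality[of h g k] by (intro Comp_eq_extend) simp_all
  also have "inv_arr C (Assoc C a' c' (b' \<otimes> d')) \<cdot> ((f \<boxtimes> \<dots>) \<cdot> Assoc C a b (c \<otimes> d)) =
      inv_arr C (Assoc C a' c' (b' \<otimes> d')) \<cdot> ((f \<boxtimes> (h \<boxtimes> (g \<boxtimes> k))) \<cdot>
      ((Ident C a \<boxtimes> (Assoc C c b d \<cdot> (Braid C b c \<boxtimes> Ident C d) \<cdot> inv_arr C (Assoc C b c d))) \<cdot>
        Assoc C a b (c \<otimes> d)))"
    by simp
  also have "\<dots> = ((f \<boxtimes> h) \<boxtimes> (g \<boxtimes> k)) \<cdot> (inv_arr C (Assoc C a c (b \<otimes> d)) \<cdot>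
      ((Ident C a \<boxtimes> (Assoc C c b d \<cdot> (Braid C b c \<boxtimes> Ident C d) \<cdot> inv_arr C (Assoc C b c d))) \<cdot>
        Assoc C a b (c \<otimes> d)))"
    using inv_Assoc_naturality[of f h "g \<boxtimes> k"] by (intro Comp_eq_extend) simp_all
  also have "\<dots> = ((f \<boxtimes> h) \<boxtimes> (g \<boxtimes> k)) \<cdot> middle_swap C a b c d"
    by (simp add: middle_swap_def)
  finally show ?thesis by simp
qed

lemma shuffle_isos:
  assumes [simp]: "c \<in> Obj C" "d \<in> Obj C"
  shows "shuffle C c d n \<in> isos C (tpow C c n \<otimes> tpow C d n) (tpow C (c \<otimes> d) n)"
  by (induction n rule: induct_nat_012) (simp_all add: in_isos_iff invertible_Arr)

lemma shuffle_type [simp]: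
  assumes "c \<in> Obj C" "d \<in> Obj C"
  shows "shuffle C c d n \<in> Arr C" "Dom C (shuffle C c d n) = tpow C c n \<otimes> tpow C d n"
    "Cod C (shuffle C c d n) = tpow C (c \<otimes> d) n" "invertible C (shuffle C c d n)"
  using shuffle_isos[OF assms, of n] invertible_Arr by (auto simp: in_isos_iff)

lemma unit_shuffle_isos: "unit_shuffle C n \<in> isos C (Unit C) (tpow C (Unit C) n)"
  by (induction n rule: induct_nat_012) (simp_all add: in_isos_iff invertible_Arr)

lemma unit_shuffle_type [simp]:
  "unit_shuffle C n \<in> Arr C" "Dom C (unit_shuffle C n) = Unit C"
  "Cod C (unit_shuffle C n) = tpow C (Unit C) n" "invertible C (unit_shuffle C n)"
  using unit_shuffle_isos[of n] invertible_Arr by (auto simp: in_isos_iff)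

end

section \<open>Braidings and shuffles in the strict case\<close>

context symmetric_strict_monoidal_category
begin

declare TensO_Unit_left [simp] TensO_Unit_right [simp] LUnit_Ident [simp] RUnit_Ident [simp]

lemma TensO_assoc_right [simp]:
  "a \<in> Obj C \<Longrightarrow> b \<in> Obj C \<Longrightarrow> c \<in> Obj C \<Longrightarrow> a \<otimes> b \<otimes> c = a \<otimes> (b \<otimes> c)"
  using TensO_assoc by simp

lemma Assoc_Ident_right [simp]:
  "a \<in> Obj C \<Longrightarrow> b \<in> Obj C \<Longrightarrow> c \<in> Obj C \<Longrightarrow> Assoc C a b c = Ident C (a \<otimes> (b \<otimes> c))"
  using Assoc_Ident by simp

lemma TensA_assoc [simp]:
  assumes "f \<in> Arr C" "g \<in> Arr C" "h \<in> Arr C"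
  shows "(f \<boxtimes> g) \<boxtimes> h = f \<boxtimes> (g \<boxtimes> h)"
  using assms Assoc_naturality[OF assms] by simp

lemma TensA_Ident_right [simp]:
  "f \<in> Arr C \<Longrightarrow> a \<in> Obj C \<Longrightarrow> b \<in> Obj C \<Longrightarrow>
    Ident C a \<boxtimes> (Ident C b \<boxtimes> f) = Ident C (a \<otimes> b) \<boxtimes> f"
  by (simp flip: TensA_assoc)

lemma TensA_Unit_simps [simp]:
  "f \<in> Arr C \<Longrightarrow> Ident C (Unit C) \<boxtimes> f = f" "f \<in> Arr C \<Longrightarrow> f \<boxtimes> Ident C (Unit C) = f"
  using LUnit_naturality[of f] RUnit_naturality[of f] by simp_all

lemma tens_append: "L \<in> lists (Obj C) \<Longrightarrow> M \<in> lists (Obj C) \<Longrightarrow> tens C (L @ M) = tens C L \<otimes> tens C M"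
proof (induction M rule: rev_induct)
  case (snoc c M)
  then show ?case
    using tens_simps(3)[of "L @ M" C c] by (cases "L = []"; cases "M = []") auto
qed simp

lemma tpow_add: "a \<in> Obj C \<Longrightarrow> tpow C a (m + n) = tpow C a m \<otimes> tpow C a n"
  by (simp add: tpow_def replicate_add tens_append in_lists_conv_set)

lemma rebracket_Ident:
  "L \<in> lists (Obj C) \<Longrightarrow> M \<in> lists (Obj C) \<Longrightarrow> rebracket C L M = Ident C (tens C L \<otimes> tens C M)"
proof (induction M rule: rev_induct)
  case (snoc c M)
  then show ?case
    using tens_append[of L M] by (cases "L = []"; cases "M = []") (auto simp: rebracket_simps)
qed (simp add: rebracket_simps)

lemma Braid_TensO_right:
  "a \<in> Obj C \<Longrightarrow> b \<in> Obj C \<Longrightarrow> c \<in> Obj C \<Longrightarrow>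
    Braid C a (b \<otimes> c) = (Ident C b \<boxtimes> Braid C a c) \<cdot> (Braid C a b \<boxtimes> Ident C c)"
  using hexagon[of a b c] by simp

lemma Braid_TensO_left:
  assumes [simp]: "a \<in> Obj C" "b \<in> Obj C" "c \<in> Obj C"
  shows "Braid C (a \<otimes> b) c = (Braid C a c \<boxtimes> Ident C b) \<cdot> (Ident C a \<boxtimes> Braid C b c)"
proof -
  have "Braid C (a \<otimes> b) c = inv_arr C (Braid C c (a \<otimes> b))" by simp
  then show ?thesis unfolding Braid_TensO_right[OF assms(3,1,2)] by (simp add: inv_arr_Comp)
qed

text \<open>The hexagon with two unit factors says that this braiding is idempotent, and an
  invertible idempotent is an identity.\<close>

lemma Braid_Unit_right [simp]: 
  assumes [simp]: "a \<in> Obj C"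
  shows "Braid C a (Unit C) = Ident C a"
proof -
  have "Braid C a (Unit C) \<cdot> Braid C a (Unit C) = Ident C a \<cdot> Braid C a (Unit C)"
    using Braid_TensO_right[of a "Unit C" "Unit C"] by simp
  then show ?thesis by (rule invertible_cancel_right) simp_all
qed

lemma Braid_Unit_left [simp]: "a \<in> Obj C \<Longrightarrow> Braid C (Unit C) a = Ident C a"
  using Braid_simps(5)[of a "Unit C"] by simp

lemma middle_swap_strict:
  "a \<in> Obj C \<Longrightarrow> b \<in> Obj C \<Longrightarrow> c \<in> Obj C \<Longrightarrow> d \<in> Obj C \<Longrightarrow>
    middle_swap C a b c d = Ident C a \<boxtimes> (Braid C b c \<boxtimes> Ident C d)"
  by (simp add: middle_swap_def)

lemma whisker_Comp:
  "f \<in> Arr C \<Longrightarrow> g \<in> Arr C \<Longrightarrow> Dom C g = Cod C f \<Longrightarrow> a \<in> Obj C \<Longrightarrow> b \<in> Obj C \<Longrightarrow>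
    Ident C a \<boxtimes> ((g \<cdot> f) \<boxtimes> Ident C b) =
    (Ident C a \<boxtimes> (g \<boxtimes> Ident C b)) \<cdot> (Ident C a \<boxtimes> (f \<boxtimes> Ident C b))"
  by simp

text \<open>Both sides realise the permutation taking a a' b b' c c' to a b c a' b' c'. The hexagons
  split the block crossings into single ones, and the only difference left is the order of two
  crossings on disjoint factors.\<close>

lemma middle_swap_assoc:
  assumes [simp]: "a \<in> Obj C" "a' \<in> Obj C" "b \<in> Obj C" "b' \<in> Obj C" "c \<in> Obj C" "c' \<in> Obj C"
  shows "middle_swap C (a \<otimes> b) (a' \<otimes> b') c c' \<cdot> (middle_swap C a a' b b' \<boxtimes> Ident C (c \<otimes> c')) =
    middle_swap C a a' (b \<otimes> c) (b' \<otimes> c') \<cdot> (Ident C (a \<otimes> a') \<boxtimes> middle_swap C b b' c c')"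
proof -
  let ?i = "Ident C"
  \<comment> \<open>The outer factors a and c' stay fixed on both sides; \<open>?X\<close> and
    \<open>?Y\<close> are what happens between them.\<close>
  let ?X = "(?i b \<boxtimes> Braid C (a' \<otimes> b') c) \<cdot> (Braid C a' b \<boxtimes> ?i (b' \<otimes> c))"
  let ?Y = "(Braid C a' (b \<otimes> c) \<boxtimes> ?i b') \<cdot> (?i (a' \<otimes> b) \<boxtimes> Braid C b' c)"
  have "?i b \<boxtimes> Braid C (a' \<otimes> b') c =
      (?i b \<boxtimes> (Braid C a' c \<boxtimes> ?i b')) \<cdot> (?i b \<boxtimes> (?i a' \<boxtimes> Braid C b' c))"
    unfolding Braid_TensO_left[of a' b' c, simplified] by (subst TensA_Comp) simp_all
  then have "?X = ((?i b \<boxtimes> (Braid C a' c \<boxtimes> ?i b')) \<cdot> (?i (b \<otimes> a') \<boxtimes> Braid C b' c)) \<cdot>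
      (Braid C a' b \<boxtimes> ?i (b' \<otimes> c))"
    by (simp del: Comp_assoc_right)
  also have "\<dots> = (?i b \<boxtimes> (Braid C a' c \<boxtimes> ?i b')) \<cdot>
      ((?i (b \<otimes> a') \<boxtimes> Braid C b' c) \<cdot> (Braid C a' b \<boxtimes> ?i (b' \<otimes> c)))"
    by (rule Comp_assoc_right) simp_all
  \<comment> \<open>The crossing of a' with b and that of b' with c act on disjoint factors, so by
    interchange they may be performed in either order.\<close>
  also have "(?i (b \<otimes> a') \<boxtimes> Braid C b' c) \<cdot> (Braid C a' b \<boxtimes> ?i (b' \<otimes> c)) =
      Braid C a' b \<boxtimes> Braid C b' c"
    by (subst TensA_Comp) simp_all
  also have "Braid C a' b \<boxtimes> Braid C b' c =
      (Braid C a' b \<boxtimes> ?i (c \<otimes> b')) \<cdot> (?i (a' \<otimes> b) \<boxtimes> Braid C b' c)"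
    by (subst TensA_Comp) simp_all
  also have "(?i b \<boxtimes> (Braid C a' c \<boxtimes> ?i b')) \<cdot> \<dots> =
      ((?i b \<boxtimes> (Braid C a' c \<boxtimes> ?i b')) \<cdot> (Braid C a' b \<boxtimes> ?i (c \<otimes> b'))) \<cdot>
      (?i (a' \<otimes> b) \<boxtimes> Braid C b' c)"
    by (rule Comp_assoc_right[symmetric]) simp_all
  also have "(?i b \<boxtimes> (Braid C a' c \<boxtimes> ?i b')) \<cdot> (Braid C a' b \<boxtimes> ?i (c \<otimes> b')) =
      ((?i b \<boxtimes> Braid C a' c) \<boxtimes> ?i b') \<cdot> ((Braid C a' b \<boxtimes> ?i c) \<boxtimes> ?i b')"
    by (simp del: TensA_Comp)
  also have "\<dots> = Braid C a' (b \<otimes> c) \<boxtimes> ?i b'"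
    unfolding Braid_TensO_right[OF assms(2,3,5)] by (subst TensA_Comp) simp_all
  finally have "?i a \<boxtimes> (?X \<boxtimes> ?i c') = ?i a \<boxtimes> (?Y \<boxtimes> ?i c')"
    by (rule arg_cong)
  moreover have "?i a \<boxtimes> (?X \<boxtimes> ?i c') =
      (?i a \<boxtimes> ((?i b \<boxtimes> Braid C (a' \<otimes> b') c) \<boxtimes> ?i c')) \<cdot>
      (?i a \<boxtimes> ((Braid C a' b \<boxtimes> ?i (b' \<otimes> c)) \<boxtimes> ?i c'))"
    by (rule whisker_Comp) simp_all
  moreover have "?i a \<boxtimes> (?Y \<boxtimes> ?i c') =
      (?i a \<boxtimes> ((Braid C a' (b \<otimes> c) \<boxtimes> ?i b') \<boxtimes> ?i c')) \<cdot>
      (?i a \<boxtimes> ((?i (a' \<otimes> b) \<boxtimes> Braid C b' c) \<boxtimes> ?i c'))"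
    by (rule whisker_Comp) simp_all
  ultimately show ?thesis
    by (simp add: middle_swap_strict del: TensA_Comp)
qed

lemma tpow_TensO_Suc: "a \<in> Obj C \<Longrightarrow> tpow C a (Suc n) = tpow C a n \<otimes> a"
  by (cases n) simp_all

lemma tpow_Unit [simp]: "tpow C (Unit C) n = Unit C"
  by (induction n) (simp_all add: tpow_TensO_Suc del: tpow_simps(3))

text \<open>With strict units the clause for one factor is an instance of the general one, so
  ordinary induction from zero becomes available.\<close>

lemma shuffle_Suc:
  "c \<in> Obj C \<Longrightarrow> d \<in> Obj C \<Longrightarrow> shuffle C c d (Suc n) =
    (shuffle C c d n \<boxtimes> Ident C (c \<otimes> d)) \<cdot> middle_swap C (tpow C c n) c (tpow C d n) d"
  by (cases n) (simp_all add: middle_swap_strict)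

lemma shuffle_Unit_right: "c \<in> Obj C \<Longrightarrow> shuffle C c (Unit C) n = Ident C (tpow C c n)"
  by (induction n) (simp_all add: shuffle_Suc middle_swap_strict tpow_TensO_Suc del: tpow_simps(3) shuffle.simps(3))

lemma shuffle_Unit_left: "c \<in> Obj C \<Longrightarrow> shuffle C (Unit C) c n = Ident C (tpow C c n)"
  by (induction n) (simp_all add: shuffle_Suc middle_swap_strict tpow_TensO_Suc del: tpow_simps(3) shuffle.simps(3))

lemma unit_shuffle_strict: "unit_shuffle C n = Ident C (Unit C)"
  by (induction n rule: induct_nat_012) simp_all

text \<open>Each shuffle of size n + 1 is one of size n followed, reading outwards, after a middle
  swap. Naturality moves all swaps to the right, where \<open>middle_swap_assoc\<close> compares
  them; the shuffles of size n are left for the induction hypothesis.\<close>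

lemma shuffle_assoc:
  assumes [simp]: "a \<in> Obj C" "b \<in> Obj C" "c \<in> Obj C"
  shows "shuffle C (a \<otimes> b) c n \<cdot> (shuffle C a b n \<boxtimes> Ident C (tpow C c n)) =
    shuffle C a (b \<otimes> c) n \<cdot> (Ident C (tpow C a n) \<boxtimes> shuffle C b c n)"
proof (induction n)
  case (Suc n)
  let ?i = "Ident C" and ?t = "tpow C" and ?m = "middle_swap C" and ?s = "\<lambda>x y. shuffle C x y n"
  let ?A = "?t a n" and ?B = "?t b n" and ?C = "?t c n"
  have "shuffle C (a \<otimes> b) c (Suc n) \<cdot> (shuffle C a b (Suc n) \<boxtimes> ?i (?t c (Suc n))) =
      (?s (a \<otimes> b) c \<boxtimes> ?i (a \<otimes> (b \<otimes> c))) \<cdot> (?m (?t (a \<otimes> b) n) (a \<otimes> b) ?C c \<cdot>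
      (((?s a b \<boxtimes> ?i (a \<otimes> b)) \<boxtimes> (?i ?C \<boxtimes> ?i c)) \<cdot> (?m ?A a ?B b \<boxtimes> ?i (?C \<otimes> c))))"
    by (simp add: shuffle_Suc tpow_TensO_Suc
        del: tpow_simps(3) shuffle.simps(3) TensA_assoc TensA_Ident_right)
  also have "\<dots> = (?s (a \<otimes> b) c \<boxtimes> ?i (a \<otimes> (b \<otimes> c))) \<cdot> (((?s a b \<boxtimes> ?i ?C) \<boxtimes> (?i (a \<otimes> b) \<boxtimes> ?i c)) \<cdot>
      (?m (?A \<otimes> ?B) (a \<otimes> b) ?C c \<cdot> (?m ?A a ?B b \<boxtimes> ?i (?C \<otimes> c))))"
    \<comment> \<open>The inner shuffle passes the outer swap, which brings the two swaps next to
      each other.\<close>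
    using middle_swap_naturality[of "?s a b" "?i (a \<otimes> b)" "?i ?C" "?i c"]
    by (intro arg_cong[where f = "\<lambda>x. _ \<cdot> x"] Comp_eq_extend) simp_all
  also have "\<dots> = ((?s (a \<otimes> b) c \<cdot> (?s a b \<boxtimes> ?i ?C)) \<boxtimes> ?i (a \<otimes> (b \<otimes> c))) \<cdot>
      (?m ?A a (?B \<otimes> ?C) (b \<otimes> c) \<cdot> (?i (?A \<otimes> a) \<boxtimes> ?m ?B b ?C c))"
    using middle_swap_assoc[of ?A a ?B b ?C c] by (simp del: TensA_assoc TensA_Ident_right)
  also have "\<dots> = (?s a (b \<otimes> c) \<boxtimes> ?i (a \<otimes> (b \<otimes> c))) \<cdot> (((?i ?A \<boxtimes> ?s b c) \<boxtimes> (?i a \<boxtimes> ?i (b \<otimes> c))) \<cdot>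
      (?m ?A a (?B \<otimes> ?C) (b \<otimes> c) \<cdot> (?i (?A \<otimes> a) \<boxtimes> ?m ?B b ?C c)))"
    using Suc.IH by (simp del: TensA_assoc TensA_Ident_right)
  also have "\<dots> = (?s a (b \<otimes> c) \<boxtimes> ?i (a \<otimes> (b \<otimes> c))) \<cdot> (?m ?A a (?t (b \<otimes> c) n) (b \<otimes> c) \<cdot>
      (((?i ?A \<boxtimes> ?i a) \<boxtimes> (?s b c \<boxtimes> ?i (b \<otimes> c))) \<cdot> (?i (?A \<otimes> a) \<boxtimes> ?m ?B b ?C c)))"
    using middle_swap_naturality[of "?i ?A" "?i a" "?s b c" "?i (b \<otimes> c)"]
    by (intro arg_cong[where f = "\<lambda>x. _ \<cdot> x"] Comp_eq_extend) simp_all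
  also have "\<dots> = shuffle C a (b \<otimes> c) (Suc n) \<cdot> (?i (?t a (Suc n)) \<boxtimes> shuffle C b c (Suc n))"
    by (simp add: shuffle_Suc tpow_TensO_Suc
        del: tpow_simps(3) shuffle.simps(3) TensA_assoc TensA_Ident_right)
  finally show ?case .
qed simp

end

section \<open>The strictification\<close>

lemma strictification_simps [simp]:
  "Obj (strictification C) = lists (Obj C)"
  "(L, f, M) \<in> Arr (strictification C) \<longleftrightarrow>
    L \<in> lists (Obj C) \<and> M \<in> lists (Obj C) \<and> f \<in> hom C (tens C L) (tens C M)"
  "Dom (strictification C) (L, f, M) = L"
  "Cod (strictification C) (L, f, M) = M"
  "Ident (strictification C) L = (L, Ident C (tens C L), L)"
  "(L', g, M') \<cdot>\<^bsub>strictification C\<^esub> (L, f, M) = (L, g \<cdot>\<^bsub>C\<^esub> f, M')"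
  "Unit (strictification C) = []"
  "L \<otimes>\<^bsub>strictification C\<^esub> M = L @ M"
  "(L, f, L') \<boxtimes>\<^bsub>strictification C\<^esub> (M, g, M') =
    (L @ M, rebracket C L' M' \<cdot>\<^bsub>C\<^esub> (f \<boxtimes>\<^bsub>C\<^esub> g) \<cdot>\<^bsub>C\<^esub> inv_arr C (rebracket C L M), L' @ M')"
  "Assoc (strictification C) L M N = (L @ M @ N, Ident C (tens C (L @ M @ N)), L @ M @ N)"
  "LUnit (strictification C) L = (L, Ident C (tens C L), L)"
  "RUnit (strictification C) L = (L, Ident C (tens C L), L)"
  "Braid (strictification C) L M =
    (L @ M,
     rebracket C M L \<cdot>\<^bsub>C\<^esub> Braid C (tens C L) (tens C M) \<cdot>\<^bsub>C\<^esub> inv_arr C (rebracket C L M),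
     M @ L)"
  by (simp_all add: strictification_def)

lemma tens_functor_simps [simp]:
  "OMap (tens_functor C) = tens C"
  "AMap (tens_functor C) (L, f, M) = f"
  "Strongator (tens_functor C) = rebracket C"
  "UStrongator (tens_functor C) = Ident C (Unit C)"
  by (simp_all add: tens_functor_def)

lemma in_hom_strictification:
  "x \<in> hom (strictification C) L M \<longleftrightarrow>
    (\<exists>f. x = (L, f, M) \<and> L \<in> lists (Obj C) \<and> M \<in> lists (Obj C) \<and>
      f \<in> Arr C \<and> Dom C f = tens C L \<and> Cod C f = tens C M)"
  by (cases x) (auto simp: in_hom_iff)

section \<open>Strictness and symmetry of the strictification, and its functor to the base\<close>

context symmetric_monoidal_category
begin

lemma category_strictification: "category (strictification C)"
  by unfold_locales (auto simp: in_hom_strictification in_hom_iff)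

lemma invertible_strictification_Ident:
  "L \<in> lists (Obj C) \<Longrightarrow> invertible (strictification C) (L, Ident C (tens C L), L)"
  using category.invertible_Ident[OF category_strictification, of L] by simp

text \<open>This is naturality of the identity associator of the strictification, that is, strict
  associativity of its tensor on arrows, spelled out in \<open>C\<close>.\<close>

lemma rebracket_assoc_natural:
  assumes [simp]: "L \<in> lists (Obj C)" "L' \<in> lists (Obj C)" "M \<in> lists (Obj C)" "M' \<in> lists (Obj C)"
    "N \<in> lists (Obj C)" "N' \<in> lists (Obj C)"
    "f \<in> Arr C" "Dom C f = tens C L" "Cod C f = tens C L'"
    "g \<in> Arr C" "Dom C g = tens C M" "Cod C g = tens C M'"
    "h \<in> Arr C" "Dom C h = tens C N" "Cod C h = tens C N'"
  shows "rebracket C (L' @ M') N' \<cdot>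
      ((rebracket C L' M' \<cdot> (f \<boxtimes> g) \<cdot> inv_arr C (rebracket C L M)) \<boxtimes> h) \<cdot>
      inv_arr C (rebracket C (L @ M) N) =
    rebracket C L' (M' @ N') \<cdot>
      (f \<boxtimes> (rebracket C M' N' \<cdot> (g \<boxtimes> h) \<cdot> inv_arr C (rebracket C M N))) \<cdot>
      inv_arr C (rebracket C L (M @ N))" (is "?l = ?r")
proof -
  let ?R = "rebracket C" and ?i = "\<lambda>L. Ident C (tens C L)"
  let ?A = "Assoc C (tens C L) (tens C M) (tens C N)"
    and ?A' = "Assoc C (tens C L') (tens C M') (tens C N')"
  \<comment> \<open>The coherence map from the triple product to \<open>tens C (L @ M @ N)\<close>.
    Precomposing with it removes the inverse rebracketings.\<close>
  let ?E = "?R (L @ M) N \<cdot> (?R L M \<boxtimes> ?i N)"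
  have "?l \<cdot> ?E = ?R (L' @ M') N' \<cdot> ((?R L' M' \<boxtimes> ?i N') \<cdot> ((f \<boxtimes> g) \<boxtimes> h))"
    by simp
  also have "\<dots> = (?R (L' @ M') N' \<cdot> (?R L' M' \<boxtimes> ?i N')) \<cdot> ((f \<boxtimes> g) \<boxtimes> h)"
    by (rule Comp_assoc_right[symmetric]) simp_all
  also have "\<dots> = ?R L' (M' @ N') \<cdot> ((?i L' \<boxtimes> ?R M' N') \<cdot> (?A' \<cdot> ((f \<boxtimes> g) \<boxtimes> h)))"
    unfolding rebracket_assoc[OF assms(2,4,6)] by simp
  also have "?A' \<cdot> ((f \<boxtimes> g) \<boxtimes> h) = (f \<boxtimes> (g \<boxtimes> h)) \<cdot> ?A"
    using Assoc_naturality[of f g h] by simp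
  also have "?R L' (M' @ N') \<cdot> ((?i L' \<boxtimes> ?R M' N') \<cdot> \<dots>) =
      ?r \<cdot> (?R L (M @ N) \<cdot> ((?i L \<boxtimes> ?R M N) \<cdot> ?A))"
    by simp
  also have "\<dots> = ?r \<cdot> ?E"
    unfolding rebracket_assoc[OF assms(1,3,5)] by simp
  finally show ?thesis by (rule invertible_cancel_right) simp_all
qed

text \<open>The hexagon of the strictification, in which all associators are identities. Three uses
  of \<open>rebracket_assoc\<close> bring out the associators needed for the hexagon of
  \<open>C\<close>, and naturality of the braiding carries \<open>rebracket C M N\<close>
  across.\<close>

lemma rebracket_hexagon:
  assumes [simp]: "L \<in> lists (Obj C)" "M \<in> lists (Obj C)" "N \<in> lists (Obj C)"
  shows "rebracket C (M @ N) L \<cdot> Braid C (tens C L) (tens C (M @ N)) \<cdot> inv_arr C (rebracket C L (M @ N)) =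
    (rebracket C M (N @ L) \<cdot>
      (Ident C (tens C M) \<boxtimes>
        (rebracket C N L \<cdot> Braid C (tens C L) (tens C N) \<cdot> inv_arr C (rebracket C L N))) \<cdot>
      inv_arr C (rebracket C M (L @ N))) \<cdot>
    (rebracket C (M @ L) N \<cdot>
      ((rebracket C M L \<cdot> Braid C (tens C L) (tens C M) \<cdot> inv_arr C (rebracket C L M)) \<boxtimes>
        Ident C (tens C N)) \<cdot>
      inv_arr C (rebracket C (L @ M) N))" (is "?l = ?u \<cdot> ?v")
proof -
  let ?R = "rebracket C" and ?i = "\<lambda>L. Ident C (tens C L)" and ?l' = "tens C L" and ?m = "tens C M"
    and ?n = "tens C N"
  let ?B = "Braid C"
  let ?E = "?R (L @ M) N \<cdot> (?R L M \<boxtimes> ?i N)"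
  have "(?u \<cdot> ?v) \<cdot> ?E = ?u \<cdot> ((?R (M @ L) N \<cdot> (?R M L \<boxtimes> ?i N)) \<cdot> (?B ?l' ?m \<boxtimes> ?i N))"
    by simp
  also have "\<dots> = ?R M (N @ L) \<cdot> ((?i M \<boxtimes> ?R N L) \<cdot> ((?i M \<boxtimes> ?B ?l' ?n) \<cdot>
      (Assoc C ?m ?l' ?n \<cdot> (?B ?l' ?m \<boxtimes> ?i N))))"
    unfolding rebracket_assoc[OF assms(2,1,3)] by simp
  also have "(?i M \<boxtimes> ?B ?l' ?n) \<cdot> (Assoc C ?m ?l' ?n \<cdot> (?B ?l' ?m \<boxtimes> ?i N)) =
      Assoc C ?m ?n ?l' \<cdot> (?B ?l' (?m \<otimes> ?n) \<cdot> Assoc C ?l' ?m ?n)"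
    using hexagon[of ?l' ?m ?n] by simp
  also have "?R M (N @ L) \<cdot> ((?i M \<boxtimes> ?R N L) \<cdot> \<dots>) =
      (?R M (N @ L) \<cdot> (?i M \<boxtimes> ?R N L) \<cdot> Assoc C ?m ?n ?l') \<cdot> (?B ?l' (?m \<otimes> ?n) \<cdot> Assoc C ?l' ?m ?n)"
    by simp
  also have "\<dots> = ?R (M @ N) L \<cdot> ((?R M N \<boxtimes> ?i L) \<cdot> (?B ?l' (?m \<otimes> ?n) \<cdot> Assoc C ?l' ?m ?n))"
    unfolding rebracket_assoc[OF assms(2,3,1), symmetric] by simp
  also have "(?R M N \<boxtimes> ?i L) \<cdot> (?B ?l' (?m \<otimes> ?n) \<cdot> Assoc C ?l' ?m ?n) =
      ?B ?l' (tens C (M @ N)) \<cdot> ((?i L \<boxtimes> ?R M N) \<cdot> Assoc C ?l' ?m ?n)"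
    using Braid_naturality[of "?i L" "?R M N"] by (intro Comp_eq_extend[OF sym]) simp_all
  also have "?R (M @ N) L \<cdot> \<dots> = ?l \<cdot> (?R L (M @ N) \<cdot> ((?i L \<boxtimes> ?R M N) \<cdot> Assoc C ?l' ?m ?n))"
    by simp
  also have "\<dots> = ?l \<cdot> ?E"
    unfolding rebracket_assoc[OF assms] by simp
  finally have "(?u \<cdot> ?v) \<cdot> ?E = ?l \<cdot> ?E" .
  then show ?thesis by (intro sym[OF invertible_cancel_right[of "?u \<cdot> ?v" ?E]]) simp_all
qed

lemma monoidal_category_strictification: "monoidal_category (strictification C)"
proof -
  interpret S: category "strictification C" by (rule category_strictification)
  let ?S = "strictification C"
  show ?thesis
  proof
    fix x y z L L' M M' N N'
    assume "x \<in> hom ?S L L'" "y \<in> hom ?S M M'" "z \<in> hom ?S N N'"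
    then show "Assoc ?S L' M' N' \<cdot>\<^bsub>?S\<^esub> (x \<boxtimes>\<^bsub>?S\<^esub> y \<boxtimes>\<^bsub>?S\<^esub> z) =
        x \<boxtimes>\<^bsub>?S\<^esub> (y \<boxtimes>\<^bsub>?S\<^esub> z) \<cdot>\<^bsub>?S\<^esub> Assoc ?S L M N"
      unfolding in_hom_strictification
      by (elim exE conjE) (simp add: rebracket_assoc_natural del: Comp_assoc_right)
  next
    fix f g x y L M N L' M' N'
    assume "f \<in> hom ?S L M" "g \<in> hom ?S M N" "x \<in> hom ?S L' M'" "y \<in> hom ?S M' N'"
    then show "(g \<cdot>\<^bsub>?S\<^esub> f) \<boxtimes>\<^bsub>?S\<^esub> (y \<cdot>\<^bsub>?S\<^esub> x) = (g \<boxtimes>\<^bsub>?S\<^esub> y) \<cdot>\<^bsub>?S\<^esub> (f \<boxtimes>\<^bsub>?S\<^esub> x)"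
      by (auto simp: in_hom_strictification)
  next
    fix x L L'
    assume "x \<in> hom ?S L L'"
    then obtain f where x: "x = (L, f, L')" and [simp]: "L \<in> lists (Obj C)" "L' \<in> lists (Obj C)"
      "f \<in> Arr C" "Dom C f = tens C L" "Cod C f = tens C L'"
      by (auto simp: in_hom_strictification)
    \<comment> \<open>Tensoring with the empty list conjugates \<open>f\<close> by unitors of
      \<open>C\<close>, which gives back \<open>f\<close> by naturality.\<close>
    have "LUnit C (tens C L') \<cdot> ((Ident C (Unit C) \<boxtimes> f) \<cdot> inv_arr C (LUnit C (tens C L))) =
        f \<cdot> (LUnit C (tens C L) \<cdot> inv_arr C (LUnit C (tens C L)))"
      using LUnit_naturality[of f] by (intro Comp_eq_extend) simp_all
    then show "LUnit ?S L' \<cdot>\<^bsub>?S\<^esub> (Ident ?S (Unit ?S) \<boxtimes>\<^bsub>?S\<^esub> x) = x \<cdot>\<^bsub>?S\<^esub> LUnit ?S L"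
      by (simp add: x rebracket_Nil_left)
    have "RUnit C (tens C L') \<cdot> ((f \<boxtimes> Ident C (Unit C)) \<cdot> inv_arr C (RUnit C (tens C L))) =
        f \<cdot> (RUnit C (tens C L) \<cdot> inv_arr C (RUnit C (tens C L)))"
      using RUnit_naturality[of f] by (intro Comp_eq_extend) simp_all
    then show "RUnit ?S L' \<cdot>\<^bsub>?S\<^esub> (x \<boxtimes>\<^bsub>?S\<^esub> Ident ?S (Unit ?S)) = x \<cdot>\<^bsub>?S\<^esub> RUnit ?S L"
      by (simp add: x rebracket_simps(1))
  \<comment> \<open>Among the remaining axioms, pentagon and triangle hold because a tensor of
    identities is an identity conjugated by a rebracketing.\<close>
  qed (auto simp: in_hom_strictification in_isos_iff invertible_strictification_Ident)
qed

theorem strictification_symmetric_strict: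
  "symmetric_strict_monoidal_category (strictification C)"
proof -
  interpret S: monoidal_category "strictification C" by (rule monoidal_category_strictification)
  let ?S = "strictification C"
  show ?thesis
  proof
    fix x y L M L' M'
    assume "x \<in> hom ?S L L'" "y \<in> hom ?S M M'"
    then obtain f g where x: "x = (L, f, L')" and y: "y = (M, g, M')"
      and [simp]: "L \<in> lists (Obj C)" "L' \<in> lists (Obj C)" "f \<in> Arr C" "Dom C f = tens C L"
        "Cod C f = tens C L'" "M \<in> lists (Obj C)" "M' \<in> lists (Obj C)" "g \<in> Arr C"
        "Dom C g = tens C M" "Cod C g = tens C M'"
      by (auto simp: in_hom_strictification)
    have "Braid C (tens C L') (tens C M') \<cdot> ((f \<boxtimes> g) \<cdot> inv_arr C (rebracket C L M)) =
        (g \<boxtimes> f) \<cdot> (Braid C (tens C L) (tens C M) \<cdot> inv_arr C (rebracket C L M))"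
      using Braid_naturality[of f g] by (intro Comp_eq_extend) simp_all
    then show "Braid ?S L' M' \<cdot>\<^bsub>?S\<^esub> (x \<boxtimes>\<^bsub>?S\<^esub> y) = (y \<boxtimes>\<^bsub>?S\<^esub> x) \<cdot>\<^bsub>?S\<^esub> Braid ?S L M"
      by (simp add: x y)
  next
    fix L M N
    assume "L \<in> Obj ?S" "M \<in> Obj ?S" "N \<in> Obj ?S"
    then show "Assoc ?S M N L \<cdot>\<^bsub>?S\<^esub> Braid ?S L (M \<otimes>\<^bsub>?S\<^esub> N) \<cdot>\<^bsub>?S\<^esub> Assoc ?S L M N =
      (Ident ?S M \<boxtimes>\<^bsub>?S\<^esub> Braid ?S L N) \<cdot>\<^bsub>?S\<^esub> Assoc ?S M L N \<cdot>\<^bsub>?S\<^esub> (Braid ?S L M \<boxtimes>\<^bsub>?S\<^esub> Ident ?S N)"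
      using rebracket_hexagon[of L M N] by simp
  qed (auto simp: in_hom_strictification)
qed

text \<open>Naturality of the strongators and compatibility with braidings are built into the
  definition of the strictification; associativity is \<open>rebracket_assoc\<close>.\<close>

theorem strong_monoidal_tens_functor:
  "strong_monoidal_functor (strictification C) C (tens_functor C)"
proof -
  interpret S: symmetric_strict_monoidal_category "strictification C"
    by (rule strictification_symmetric_strict)
  show ?thesis
  proof
    fix L M N
    assume "L \<in> Obj (strictification C)" "M \<in> Obj (strictification C)" "N \<in> Obj (strictification C)"
    then show "AMap (tens_functor C) (Assoc (strictification C) L M N) \<cdot>
      Strongator (tens_functor C) (L \<otimes>\<^bsub>strictification C\<^esub> M) N \<cdot>
        (Strongator (tens_functor C) L M \<boxtimes> Ident C (OMap (tens_functor C) N)) =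
      Strongator (tens_functor C) L (M \<otimes>\<^bsub>strictification C\<^esub> N) \<cdot>
        (Ident C (OMap (tens_functor C) L) \<boxtimes> Strongator (tens_functor C) M N) \<cdot>
        Assoc C (OMap (tens_functor C) L) (OMap (tens_functor C) M) (OMap (tens_functor C) N)"
      using rebracket_assoc[of L M N] by simp
  qed (auto simp: in_hom_strictification in_isos_iff in_hom_iff[where C = C] rebracket_Nil_left
      rebracket_simps(1))
qed

end

section \<open>Strong monoidal functors and iterated strongators\<close>

context strong_monoidal_functor
begin

declare OMap_Obj [simp] AMap_Ident [simp]

lemma AMap_type [simp]:
  assumes "f \<in> Arr A"
  shows "AMap F f \<in> Arr B" "Dom B (AMap F f) = OMap F (Dom A f)" "Cod B (AMap F f) = OMap F (Cod A f)"
  using AMap_hom[of f "Dom A f" "Cod A f"] assms by (auto simp: in_hom_iff)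

lemma AMap_Comp' [simp]:
  "f \<in> Arr A \<Longrightarrow> g \<in> Arr A \<Longrightarrow> Dom A g = Cod A f \<Longrightarrow>
    AMap F (g \<cdot>\<^bsub>A\<^esub> f) = AMap F g \<cdot>\<^bsub>B\<^esub> AMap F f"
  using AMap_Comp[of f "Dom A f" "Cod A f" g "Cod A g"] by (auto simp: in_hom_iff)

lemma Strongator_type [simp]:
  assumes "a \<in> Obj A" "b \<in> Obj A"
  shows "invertible B (Strongator F a b)" "Strongator F a b \<in> Arr B"
    "Dom B (Strongator F a b) = OMap F a \<otimes>\<^bsub>B\<^esub> OMap F b"
    "Cod B (Strongator F a b) = OMap F (a \<otimes>\<^bsub>A\<^esub> b)"
  using Strongator_iso[OF assms] invertible_Arr by (auto simp: in_isos_iff)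

lemma UStrongator_type [simp]:
  "invertible B (UStrongator F)" "UStrongator F \<in> Arr B"
  "Dom B (UStrongator F) = Unit B" "Cod B (UStrongator F) = OMap F (Unit A)"
  using UStrongator_iso invertible_Arr by (auto simp: in_isos_iff)

lemma Strongator_naturality:
  "f \<in> Arr A \<Longrightarrow> g \<in> Arr A \<Longrightarrow>
    AMap F (f \<boxtimes>\<^bsub>A\<^esub> g) \<cdot>\<^bsub>B\<^esub> Strongator F (Dom A f) (Dom A g) =
    Strongator F (Cod A f) (Cod A g) \<cdot>\<^bsub>B\<^esub> (AMap F f \<boxtimes>\<^bsub>B\<^esub> AMap F g)"
  by (rule Strongator_natural[symmetric]) (auto simp: in_hom_iff)

lemma strongator_pow_isos:
  assumes [simp]: "a \<in> Obj A"
  shows "strongator_pow A B F a n \<in> isos B (tpow B (OMap F a) n) (OMap F (tpow A a n))"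
  by (induction n rule: induct_nat_012) (simp_all add: in_isos_iff invertible_Arr)

lemma strongator_pow_type [simp]:
  assumes "a \<in> Obj A"
  shows "invertible B (strongator_pow A B F a n)" "strongator_pow A B F a n \<in> Arr B"
    "Dom B (strongator_pow A B F a n) = tpow B (OMap F a) n"
    "Cod B (strongator_pow A B F a n) = OMap F (tpow A a n)"
  using strongator_pow_isos[OF assms, of n] invertible_Arr by (auto simp: in_isos_iff)

end

text \<open>The situation of \<open>tens_functor\<close>: the source is strict while the target is
  arbitrary. The associator of the source is an identity and drops out of the associativity
  axiom.\<close>

locale strong_monoidal_functor_on_strict =
  strong_monoidal_functor + A: symmetric_strict_monoidal_category A
begin

abbreviation \<Phi> where "\<Phi> \<equiv> Strongator F"
abbreviation \<phi> where "\<phi> \<equiv> strongator_pow A B F"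

lemma Strongator_assoc_strict:
  "a \<in> Obj A \<Longrightarrow> b \<in> Obj A \<Longrightarrow> c \<in> Obj A \<Longrightarrow>
    \<Phi> (a \<otimes>\<^bsub>A\<^esub> b) c \<cdot>\<^bsub>B\<^esub> (\<Phi> a b \<boxtimes>\<^bsub>B\<^esub> Ident B (OMap F c)) =
    \<Phi> a (b \<otimes>\<^bsub>A\<^esub> c) \<cdot>\<^bsub>B\<^esub> (Ident B (OMap F a) \<boxtimes>\<^bsub>B\<^esub> \<Phi> b c) \<cdot>\<^bsub>B\<^esub>
      Assoc B (OMap F a) (OMap F b) (OMap F c)"
  using Strongator_Assoc[of a b c] by simp

lemma Strongator_inv_assoc_strict:
  assumes [simp]: "a \<in> Obj A" "b \<in> Obj A" "c \<in> Obj A"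
  shows "\<Phi> (a \<otimes>\<^bsub>A\<^esub> b) c \<cdot>\<^bsub>B\<^esub> (\<Phi> a b \<boxtimes>\<^bsub>B\<^esub> Ident B (OMap F c)) \<cdot>\<^bsub>B\<^esub>
      inv_arr B (Assoc B (OMap F a) (OMap F b) (OMap F c)) =
    \<Phi> a (b \<otimes>\<^bsub>A\<^esub> c) \<cdot>\<^bsub>B\<^esub> (Ident B (OMap F a) \<boxtimes>\<^bsub>B\<^esub> \<Phi> b c)"
proof -
  let ?\<alpha> = "Assoc B (OMap F a) (OMap F b) (OMap F c)"
  have "(\<Phi> (a \<otimes>\<^bsub>A\<^esub> b) c \<cdot>\<^bsub>B\<^esub> (\<Phi> a b \<boxtimes>\<^bsub>B\<^esub> Ident B (OMap F c))) \<cdot>\<^bsub>B\<^esub> inv_arr B ?\<alpha> =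
    \<Phi> a (b \<otimes>\<^bsub>A\<^esub> c) \<cdot>\<^bsub>B\<^esub> (Ident B (OMap F a) \<boxtimes>\<^bsub>B\<^esub> \<Phi> b c)"
    unfolding Strongator_assoc_strict[OF assms] by simp
  then show ?thesis by simp
qed

lemma strongator_pow_Suc:
  assumes [simp]: "a \<in> Obj A"
  shows "strongator_pow A B F a (Suc (Suc n)) =
    \<Phi> (tpow A a (Suc n)) a \<cdot>\<^bsub>B\<^esub> (\<phi> a (Suc n) \<boxtimes>\<^bsub>B\<^esub> Ident B (OMap F a))"
  by simp

text \<open>The two ways from \<open>(F a)^m \<otimes> (F a)^n\<close> to \<open>F (a^(m+n))\<close>
  agree. This translates the rebracketings that a supply prescribes as strongators into strongators
  of \<open>F\<close>.\<close>

lemma strongator_pow_add: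
  assumes [simp]: "a \<in> Obj A"
  shows "\<phi> a (m + n) \<cdot>\<^bsub>B\<^esub> rebracket B (replicate m (OMap F a)) (replicate n (OMap F a)) =
    \<Phi> (tpow A a m) (tpow A a n) \<cdot>\<^bsub>B\<^esub> (\<phi> a m \<boxtimes>\<^bsub>B\<^esub> \<phi> a n)"
proof -
  let ?b = "OMap F a"
  let ?T = "tpow A a" and ?U = "tpow B ?b" and ?i = "Ident B"
  have [simp]: "replicate k ?b \<in> lists (Obj B)" for k by (simp add: in_lists_conv_set)
  have tens_U: "tens B (replicate k ?b) = ?U k" for k by (simp add: tpow_def)
  \<comment> \<open>The unit axioms of \<open>F\<close> settle the zero cases. They are kept out of
    the induction because the recursive clause of \<open>rebracket\<close> needs both lists
    nonempty.\<close>
  consider "n = 0" | k where "n = Suc k" "m = 0" | j k where "n = Suc k" "m = Suc j"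
    by (cases m; cases n) auto
  then show ?thesis
  proof cases
    case 1
    have "\<Phi> (?T m) (Unit A) \<cdot>\<^bsub>B\<^esub> (\<phi> a m \<boxtimes>\<^bsub>B\<^esub> UStrongator F) =
        (\<Phi> (?T m) (Unit A) \<cdot>\<^bsub>B\<^esub> (?i (OMap F (?T m)) \<boxtimes>\<^bsub>B\<^esub> UStrongator F)) \<cdot>\<^bsub>B\<^esub> (\<phi> a m \<boxtimes>\<^bsub>B\<^esub> ?i (Unit B))"
      by simp
    also have "\<dots> = RUnit B (OMap F (?T m)) \<cdot>\<^bsub>B\<^esub> (\<phi> a m \<boxtimes>\<^bsub>B\<^esub> ?i (Unit B))"
      using Strongator_RUnit[of "?T m"] by simp
    also have "\<dots> = \<phi> a m \<cdot>\<^bsub>B\<^esub> RUnit B (?U m)"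
      using B.RUnit_naturality[of "\<phi> a m"] by simp
    finally show ?thesis using 1 by (simp add: rebracket_simps tens_U)
  next
    case 2
    have "\<Phi> (Unit A) (?T n) \<cdot>\<^bsub>B\<^esub> (UStrongator F \<boxtimes>\<^bsub>B\<^esub> \<phi> a n) =
        (\<Phi> (Unit A) (?T n) \<cdot>\<^bsub>B\<^esub> (UStrongator F \<boxtimes>\<^bsub>B\<^esub> ?i (OMap F (?T n)))) \<cdot>\<^bsub>B\<^esub> (?i (Unit B) \<boxtimes>\<^bsub>B\<^esub> \<phi> a n)"
      by simp
    also have "\<dots> = LUnit B (OMap F (?T n)) \<cdot>\<^bsub>B\<^esub> (?i (Unit B) \<boxtimes>\<^bsub>B\<^esub> \<phi> a n)"
      using Strongator_LUnit[of "?T n"] by simp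
    also have "\<dots> = \<phi> a n \<cdot>\<^bsub>B\<^esub> LUnit B (?U n)"
      using B.LUnit_naturality[of "\<phi> a n"] by simp
    finally show ?thesis using 2 tens_U[of n] by (simp add: B.rebracket_Nil_left)
  next
    case (3 j k)
    have "\<phi> a (Suc j + Suc k) \<cdot>\<^bsub>B\<^esub> rebracket B (replicate (Suc j) ?b) (replicate (Suc k) ?b) =
      \<Phi> (?T (Suc j)) (?T (Suc k)) \<cdot>\<^bsub>B\<^esub> (\<phi> a (Suc j) \<boxtimes>\<^bsub>B\<^esub> \<phi> a (Suc k))"
    proof (induction k)
      case 0
      have "rebracket B (replicate (Suc j) ?b) [?b] = ?i (?U (Suc j) \<otimes>\<^bsub>B\<^esub> ?b)"
        using tens_U[of "Suc j"] by (simp add: rebracket_simps(3))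
      then show ?case by simp
    next
      case (Suc k)
      let ?m = "Suc j" and ?n = "Suc k"
      let ?r = "rebracket B (replicate ?m ?b) (replicate ?n ?b)"
      have [simp]: "?r \<in> Arr B" "Dom B ?r = ?U ?m \<otimes>\<^bsub>B\<^esub> ?U ?n" "Cod B ?r = ?U (?m + ?n)"
        using B.rebracket_type[of "replicate ?m ?b" "replicate ?n ?b"]
        by (simp_all only: tens_U flip: replicate_add) simp_all
      have r: "rebracket B (replicate ?m ?b) (replicate (Suc ?n) ?b) =
          (?r \<boxtimes>\<^bsub>B\<^esub> ?i ?b) \<cdot>\<^bsub>B\<^esub> inv_arr B (Assoc B (?U ?m) (?U ?n) ?b)"
        using rebracket_simps(4)[of "replicate ?m ?b" "replicate ?n ?b" B ?b]
        by (simp only: tens_U replicate_append_same) simp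
      have T: "?T (?m + ?n) = ?T ?m \<otimes>\<^bsub>A\<^esub> ?T ?n" by (rule A.tpow_add) simp
      have "\<phi> a (?m + Suc ?n) \<cdot>\<^bsub>B\<^esub> rebracket B (replicate ?m ?b) (replicate (Suc ?n) ?b) =
          \<Phi> (?T (?m + ?n)) a \<cdot>\<^bsub>B\<^esub> (((\<phi> a (?m + ?n) \<cdot>\<^bsub>B\<^esub> ?r) \<boxtimes>\<^bsub>B\<^esub> ?i ?b) \<cdot>\<^bsub>B\<^esub>
            inv_arr B (Assoc B (?U ?m) (?U ?n) ?b))"
        using strongator_pow_Suc[of a "j + Suc k"] unfolding r
        by (simp del: tpow_simps strongator_pow.simps replicate_Suc)
      also have "\<dots> = \<Phi> (?T ?m \<otimes>\<^bsub>A\<^esub> ?T ?n) a \<cdot>\<^bsub>B\<^esub> ((\<Phi> (?T ?m) (?T ?n) \<boxtimes>\<^bsub>B\<^esub> ?i ?b) \<cdot>\<^bsub>B\<^esub>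
            (((\<phi> a ?m \<boxtimes>\<^bsub>B\<^esub> \<phi> a ?n) \<boxtimes>\<^bsub>B\<^esub> ?i ?b) \<cdot>\<^bsub>B\<^esub> inv_arr B (Assoc B (?U ?m) (?U ?n) ?b)))"
        unfolding Suc.IH T by (simp del: tpow_simps strongator_pow.simps)
      \<comment> \<open>Moving the iterated strongators before the inverse associator leaves the
        left-hand side of \<open>Strongator_inv_assoc_strict\<close> in front.\<close>
      also have "((\<phi> a ?m \<boxtimes>\<^bsub>B\<^esub> \<phi> a ?n) \<boxtimes>\<^bsub>B\<^esub> ?i ?b) \<cdot>\<^bsub>B\<^esub> inv_arr B (Assoc B (?U ?m) (?U ?n) ?b) =
          inv_arr B (Assoc B (OMap F (?T ?m)) (OMap F (?T ?n)) ?b) \<cdot>\<^bsub>B\<^esub> (\<phi> a ?m \<boxtimes>\<^bsub>B\<^esub> (\<phi> a ?n \<boxtimes>\<^bsub>B\<^esub> ?i ?b))"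
        using B.inv_Assoc_naturality[of "\<phi> a ?m" "\<phi> a ?n" "?i ?b"]
        by (simp del: tpow_simps strongator_pow.simps)
      also have "\<Phi> (?T ?m \<otimes>\<^bsub>A\<^esub> ?T ?n) a \<cdot>\<^bsub>B\<^esub> ((\<Phi> (?T ?m) (?T ?n) \<boxtimes>\<^bsub>B\<^esub> ?i ?b) \<cdot>\<^bsub>B\<^esub> \<dots>) =
          (\<Phi> (?T ?m \<otimes>\<^bsub>A\<^esub> ?T ?n) a \<cdot>\<^bsub>B\<^esub> (\<Phi> (?T ?m) (?T ?n) \<boxtimes>\<^bsub>B\<^esub> ?i ?b) \<cdot>\<^bsub>B\<^esub>
            inv_arr B (Assoc B (OMap F (?T ?m)) (OMap F (?T ?n)) ?b)) \<cdot>\<^bsub>B\<^esub>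
            (\<phi> a ?m \<boxtimes>\<^bsub>B\<^esub> (\<phi> a ?n \<boxtimes>\<^bsub>B\<^esub> ?i ?b))"
        by (simp del: tpow_simps strongator_pow.simps)
      also have "\<dots> = \<Phi> (?T ?m) (?T (Suc ?n)) \<cdot>\<^bsub>B\<^esub> (\<phi> a ?m \<boxtimes>\<^bsub>B\<^esub>
          (\<Phi> (?T ?n) a \<cdot>\<^bsub>B\<^esub> (\<phi> a ?n \<boxtimes>\<^bsub>B\<^esub> ?i ?b)))"
        by (subst Strongator_inv_assoc_strict)
          (simp_all add: A.tpow_TensO_Suc[of a "Suc k"] del: tpow_simps strongator_pow.simps)
      finally show ?case by simp
    qed
    then show ?thesis using 3 by simp
  qed
qed

text \<open>In the strict source the middle swap is a whiskered braiding. Bracketing the target so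
  that the two exchanged factors stand together reduces the claim to naturality of the strongators
  and the braiding axiom of \<open>F\<close>.\<close>

lemma AMap_middle_swap:
  assumes [simp]: "a \<in> Obj A" "b \<in> Obj A" "c \<in> Obj A" "d \<in> Obj A"
  shows "AMap F (middle_swap A a b c d) \<cdot>\<^bsub>B\<^esub> \<Phi> (a \<otimes>\<^bsub>A\<^esub> b) (c \<otimes>\<^bsub>A\<^esub> d) \<cdot>\<^bsub>B\<^esub> (\<Phi> a b \<boxtimes>\<^bsub>B\<^esub> \<Phi> c d) =
    \<Phi> (a \<otimes>\<^bsub>A\<^esub> c) (b \<otimes>\<^bsub>A\<^esub> d) \<cdot>\<^bsub>B\<^esub> (\<Phi> a c \<boxtimes>\<^bsub>B\<^esub> \<Phi> b d) \<cdot>\<^bsub>B\<^esub>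
      middle_swap B (OMap F a) (OMap F b) (OMap F c) (OMap F d)"
proof -
  let ?o = "OMap F" and ?i = "\<lambda>x. Ident B (OMap F x)" and ?\<alpha> = "\<lambda>x y z. Assoc B (OMap F x) (OMap F y) (OMap F z)"
  \<comment> \<open>The iterated strongator out of
    \<open>F a \<otimes> ((F b \<otimes> F c) \<otimes> F d)\<close>, the bracketing in which the
    middle braiding can act.\<close>
  define Y where "Y b c = \<Phi> a (b \<otimes>\<^bsub>A\<^esub> (c \<otimes>\<^bsub>A\<^esub> d)) \<cdot>\<^bsub>B\<^esub>
      (?i a \<boxtimes>\<^bsub>B\<^esub> (\<Phi> (b \<otimes>\<^bsub>A\<^esub> c) d \<cdot>\<^bsub>B\<^esub> (\<Phi> b c \<boxtimes>\<^bsub>B\<^esub> ?i d)))" for b c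
  have X: "\<Phi> (a \<otimes>\<^bsub>A\<^esub> b) (c \<otimes>\<^bsub>A\<^esub> d) \<cdot>\<^bsub>B\<^esub> (\<Phi> a b \<boxtimes>\<^bsub>B\<^esub> \<Phi> c d) =
      Y b c \<cdot>\<^bsub>B\<^esub> ((?i a \<boxtimes>\<^bsub>B\<^esub> inv_arr B (?\<alpha> b c d)) \<cdot>\<^bsub>B\<^esub> Assoc B (?o a) (?o b) (?o c \<otimes>\<^bsub>B\<^esub> ?o d))"
    if [simp]: "b \<in> Obj A" "c \<in> Obj A" for b c
  proof -
    have "\<Phi> (a \<otimes>\<^bsub>A\<^esub> b) (c \<otimes>\<^bsub>A\<^esub> d) \<cdot>\<^bsub>B\<^esub> (\<Phi> a b \<boxtimes>\<^bsub>B\<^esub> \<Phi> c d) =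
        (\<Phi> (a \<otimes>\<^bsub>A\<^esub> b) (c \<otimes>\<^bsub>A\<^esub> d) \<cdot>\<^bsub>B\<^esub> (\<Phi> a b \<boxtimes>\<^bsub>B\<^esub> ?i (c \<otimes>\<^bsub>A\<^esub> d))) \<cdot>\<^bsub>B\<^esub> ((?i a \<boxtimes>\<^bsub>B\<^esub> ?i b) \<boxtimes>\<^bsub>B\<^esub> \<Phi> c d)"
      by simp
    also have "\<dots> = \<Phi> a (b \<otimes>\<^bsub>A\<^esub> (c \<otimes>\<^bsub>A\<^esub> d)) \<cdot>\<^bsub>B\<^esub> ((?i a \<boxtimes>\<^bsub>B\<^esub> \<Phi> b (c \<otimes>\<^bsub>A\<^esub> d)) \<cdot>\<^bsub>B\<^esub>
        (?\<alpha> a b (c \<otimes>\<^bsub>A\<^esub> d) \<cdot>\<^bsub>B\<^esub> ((?i a \<boxtimes>\<^bsub>B\<^esub> ?i b) \<boxtimes>\<^bsub>B\<^esub> \<Phi> c d)))"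
      by (subst Strongator_assoc_strict) (simp_all del: B.TensA_Ident)
    also have "?\<alpha> a b (c \<otimes>\<^bsub>A\<^esub> d) \<cdot>\<^bsub>B\<^esub> ((?i a \<boxtimes>\<^bsub>B\<^esub> ?i b) \<boxtimes>\<^bsub>B\<^esub> \<Phi> c d) =
        (?i a \<boxtimes>\<^bsub>B\<^esub> (?i b \<boxtimes>\<^bsub>B\<^esub> \<Phi> c d)) \<cdot>\<^bsub>B\<^esub> Assoc B (?o a) (?o b) (?o c \<otimes>\<^bsub>B\<^esub> ?o d)"
      using B.Assoc_naturality[of "?i a" "?i b" "\<Phi> c d"] by simp
    also have "\<Phi> a (b \<otimes>\<^bsub>A\<^esub> (c \<otimes>\<^bsub>A\<^esub> d)) \<cdot>\<^bsub>B\<^esub> ((?i a \<boxtimes>\<^bsub>B\<^esub> \<Phi> b (c \<otimes>\<^bsub>A\<^esub> d)) \<cdot>\<^bsub>B\<^esub> \<dots>) =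
        \<Phi> a (b \<otimes>\<^bsub>A\<^esub> (c \<otimes>\<^bsub>A\<^esub> d)) \<cdot>\<^bsub>B\<^esub> ((?i a \<boxtimes>\<^bsub>B\<^esub> (\<Phi> b (c \<otimes>\<^bsub>A\<^esub> d) \<cdot>\<^bsub>B\<^esub> (?i b \<boxtimes>\<^bsub>B\<^esub> \<Phi> c d))) \<cdot>\<^bsub>B\<^esub>
          Assoc B (?o a) (?o b) (?o c \<otimes>\<^bsub>B\<^esub> ?o d))"
      by simp
    also have "\<dots> = Y b c \<cdot>\<^bsub>B\<^esub> ((?i a \<boxtimes>\<^bsub>B\<^esub> inv_arr B (?\<alpha> b c d)) \<cdot>\<^bsub>B\<^esub>
        Assoc B (?o a) (?o b) (?o c \<otimes>\<^bsub>B\<^esub> ?o d))"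
      unfolding Y_def Strongator_inv_assoc_strict[OF that assms(4), symmetric] by simp
    finally show ?thesis .
  qed
  have [simp]: "Y b c \<in> Arr B" "Dom B (Y b c) = ?o a \<otimes>\<^bsub>B\<^esub> ((?o b \<otimes>\<^bsub>B\<^esub> ?o c) \<otimes>\<^bsub>B\<^esub> ?o d)"
    "Cod B (Y b c) = ?o (a \<otimes>\<^bsub>A\<^esub> (b \<otimes>\<^bsub>A\<^esub> (c \<otimes>\<^bsub>A\<^esub> d)))"
    if "b \<in> Obj A" "c \<in> Obj A" for b c
    using that by (simp_all add: Y_def)
  \<comment> \<open>Naturality of the strongator is used twice, once for each object whiskering the
    braiding.\<close>
  have Y: "AMap F (middle_swap A a b c d) \<cdot>\<^bsub>B\<^esub> Y b c =
      Y c b \<cdot>\<^bsub>B\<^esub> (?i a \<boxtimes>\<^bsub>B\<^esub> (Braid B (?o b) (?o c) \<boxtimes>\<^bsub>B\<^esub> ?i d))"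
  proof -
    have "AMap F (Ident A a \<boxtimes>\<^bsub>A\<^esub> (Braid A b c \<boxtimes>\<^bsub>A\<^esub> Ident A d)) \<cdot>\<^bsub>B\<^esub>
        (\<Phi> a (b \<otimes>\<^bsub>A\<^esub> (c \<otimes>\<^bsub>A\<^esub> d)) \<cdot>\<^bsub>B\<^esub>
          (?i a \<boxtimes>\<^bsub>B\<^esub> (\<Phi> (b \<otimes>\<^bsub>A\<^esub> c) d \<cdot>\<^bsub>B\<^esub> (\<Phi> b c \<boxtimes>\<^bsub>B\<^esub> ?i d)))) =
        \<Phi> a (c \<otimes>\<^bsub>A\<^esub> (b \<otimes>\<^bsub>A\<^esub> d)) \<cdot>\<^bsub>B\<^esub> ((?i a \<boxtimes>\<^bsub>B\<^esub> AMap F (Braid A b c \<boxtimes>\<^bsub>A\<^esub> Ident A d)) \<cdot>\<^bsub>B\<^esub>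
          (?i a \<boxtimes>\<^bsub>B\<^esub> (\<Phi> (b \<otimes>\<^bsub>A\<^esub> c) d \<cdot>\<^bsub>B\<^esub> (\<Phi> b c \<boxtimes>\<^bsub>B\<^esub> ?i d))))"
      using Strongator_naturality[of "Ident A a" "Braid A b c \<boxtimes>\<^bsub>A\<^esub> Ident A d"]
      by (intro B.Comp_eq_extend) simp_all
    also have "\<dots> = \<Phi> a (c \<otimes>\<^bsub>A\<^esub> (b \<otimes>\<^bsub>A\<^esub> d)) \<cdot>\<^bsub>B\<^esub>
          (?i a \<boxtimes>\<^bsub>B\<^esub> (AMap F (Braid A b c \<boxtimes>\<^bsub>A\<^esub> Ident A d) \<cdot>\<^bsub>B\<^esub> (\<Phi> (b \<otimes>\<^bsub>A\<^esub> c) d \<cdot>\<^bsub>B\<^esub> (\<Phi> b c \<boxtimes>\<^bsub>B\<^esub> ?i d))))"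
      by simp
    also have "AMap F (Braid A b c \<boxtimes>\<^bsub>A\<^esub> Ident A d) \<cdot>\<^bsub>B\<^esub> (\<Phi> (b \<otimes>\<^bsub>A\<^esub> c) d \<cdot>\<^bsub>B\<^esub> (\<Phi> b c \<boxtimes>\<^bsub>B\<^esub> ?i d)) =
        \<Phi> (c \<otimes>\<^bsub>A\<^esub> b) d \<cdot>\<^bsub>B\<^esub> ((AMap F (Braid A b c) \<boxtimes>\<^bsub>B\<^esub> ?i d) \<cdot>\<^bsub>B\<^esub> (\<Phi> b c \<boxtimes>\<^bsub>B\<^esub> ?i d))"
      using Strongator_naturality[of "Braid A b c" "Ident A d"]
      by (intro B.Comp_eq_extend) simp_all
    also have "(AMap F (Braid A b c) \<boxtimes>\<^bsub>B\<^esub> ?i d) \<cdot>\<^bsub>B\<^esub> (\<Phi> b c \<boxtimes>\<^bsub>B\<^esub> ?i d) =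
        (\<Phi> c b \<boxtimes>\<^bsub>B\<^esub> ?i d) \<cdot>\<^bsub>B\<^esub> (Braid B (?o b) (?o c) \<boxtimes>\<^bsub>B\<^esub> ?i d)"
      using Strongator_Braid[of b c] by simp
    finally show ?thesis by (simp add: A.middle_swap_strict Y_def)
  qed
  let ?a = "(?i a \<boxtimes>\<^bsub>B\<^esub> inv_arr B (?\<alpha> b c d)) \<cdot>\<^bsub>B\<^esub> Assoc B (?o a) (?o b) (?o c \<otimes>\<^bsub>B\<^esub> ?o d)"
  have "AMap F (middle_swap A a b c d) \<cdot>\<^bsub>B\<^esub> \<Phi> (a \<otimes>\<^bsub>A\<^esub> b) (c \<otimes>\<^bsub>A\<^esub> d) \<cdot>\<^bsub>B\<^esub> (\<Phi> a b \<boxtimes>\<^bsub>B\<^esub> \<Phi> c d) =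
      Y c b \<cdot>\<^bsub>B\<^esub> ((?i a \<boxtimes>\<^bsub>B\<^esub> (Braid B (?o b) (?o c) \<boxtimes>\<^bsub>B\<^esub> ?i d)) \<cdot>\<^bsub>B\<^esub> ?a)"
    unfolding X[OF assms(2,3)] using Y by (intro B.Comp_eq_extend) simp_all
  \<comment> \<open>The associators of \<open>middle_swap\<close> after its braiding are exactly
    inverse to those that \<open>X\<close> produces for the exchanged pair.\<close>
  also have "\<dots> = (Y c b \<cdot>\<^bsub>B\<^esub> ((?i a \<boxtimes>\<^bsub>B\<^esub> inv_arr B (?\<alpha> c b d)) \<cdot>\<^bsub>B\<^esub>
      Assoc B (?o a) (?o c) (?o b \<otimes>\<^bsub>B\<^esub> ?o d))) \<cdot>\<^bsub>B\<^esub> middle_swap B (?o a) (?o b) (?o c) (?o d)"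
    by (simp add: middle_swap_def)
  also have "\<dots> = \<Phi> (a \<otimes>\<^bsub>A\<^esub> c) (b \<otimes>\<^bsub>A\<^esub> d) \<cdot>\<^bsub>B\<^esub> (\<Phi> a c \<boxtimes>\<^bsub>B\<^esub> \<Phi> b d) \<cdot>\<^bsub>B\<^esub>
      middle_swap B (?o a) (?o b) (?o c) (?o d)"
    unfolding X[OF assms(3,2), symmetric] by simp
  finally show ?thesis .
qed

text \<open>The hypothesis on \<open>\<Phi> a b\<close> makes \<open>F (a \<otimes> b)\<close> equal
  to \<open>F a \<otimes> F b\<close>, so that a shuffle of the target ends where
  \<open>\<phi> (a \<otimes> b) n\<close> begins.\<close>

lemma strongator_pow_shuffle:
  assumes [simp]: "a \<in> Obj A" "b \<in> Obj A"
    and \<Phi>_ab: "\<Phi> a b = Ident B (OMap F a \<otimes>\<^bsub>B\<^esub> OMap F b)"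
  shows "AMap F (shuffle A a b n) \<cdot>\<^bsub>B\<^esub> \<Phi> (tpow A a n) (tpow A b n) \<cdot>\<^bsub>B\<^esub> (\<phi> a n \<boxtimes>\<^bsub>B\<^esub> \<phi> b n) =
    \<phi> (a \<otimes>\<^bsub>A\<^esub> b) n \<cdot>\<^bsub>B\<^esub> shuffle B (OMap F a) (OMap F b) n"
proof (induction n rule: induct_nat_012)
  let ?I = "Unit A"
  case 0
  \<comment> \<open>For n = 0 the claim compares two maps out of the tensor square of the unit; the
    left unit axiom of \<open>F\<close> evaluates the side containing the strongator.\<close>
  have "\<Phi> ?I ?I \<cdot>\<^bsub>B\<^esub> (UStrongator F \<boxtimes>\<^bsub>B\<^esub> UStrongator F) =
      (\<Phi> ?I ?I \<cdot>\<^bsub>B\<^esub> (UStrongator F \<boxtimes>\<^bsub>B\<^esub> Ident B (OMap F ?I))) \<cdot>\<^bsub>B\<^esub> (Ident B (Unit B) \<boxtimes>\<^bsub>B\<^esub> UStrongator F)"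
    by simp
  also have "\<dots> = LUnit B (OMap F ?I) \<cdot>\<^bsub>B\<^esub> (Ident B (Unit B) \<boxtimes>\<^bsub>B\<^esub> UStrongator F)"
    using Strongator_LUnit[of ?I] by simp
  also have "\<dots> = UStrongator F \<cdot>\<^bsub>B\<^esub> LUnit B (Unit B)"
    using B.LUnit_naturality[of "UStrongator F"] by simp
  finally show ?case by simp
next
  \<comment> \<open>The equality of objects is read off from the codomain of the strongator, which
    is assumed to be an identity.\<close>
  have ab [simp]: "OMap F (a \<otimes>\<^bsub>A\<^esub> b) = OMap F a \<otimes>\<^bsub>B\<^esub> OMap F b"
    using Strongator_type(4)[of a b] by (simp add: \<Phi>_ab)
  {
    case 1
    show ?case by (simp add: \<Phi>_ab)
  next
    case (ge2 n)
    let ?k = "Suc n"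
    let ?A = "tpow A a ?k" and ?B = "tpow A b ?k" and ?ab = "a \<otimes>\<^bsub>A\<^esub> b" and ?i = "Ident B"
    let ?s = "shuffle A a b ?k" and ?fa = "OMap F a" and ?fb = "OMap F b"
    let ?ms = "middle_swap B (tpow B ?fa ?k) ?fa (tpow B ?fb ?k) ?fb"
    have ms: "middle_swap B (OMap F ?A) ?fa (OMap F ?B) ?fb \<cdot>\<^bsub>B\<^esub>
        ((\<phi> a ?k \<boxtimes>\<^bsub>B\<^esub> ?i ?fa) \<boxtimes>\<^bsub>B\<^esub> (\<phi> b ?k \<boxtimes>\<^bsub>B\<^esub> ?i ?fb)) =
        ((\<phi> a ?k \<boxtimes>\<^bsub>B\<^esub> \<phi> b ?k) \<boxtimes>\<^bsub>B\<^esub> (?i ?fa \<boxtimes>\<^bsub>B\<^esub> ?i ?fb)) \<cdot>\<^bsub>B\<^esub> ?ms"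
      using B.middle_swap_naturality[of "\<phi> a ?k" "?i ?fa" "\<phi> b ?k" "?i ?fb"] by simp
    have "AMap F (shuffle A a b (Suc ?k)) \<cdot>\<^bsub>B\<^esub> \<Phi> (tpow A a (Suc ?k)) (tpow A b (Suc ?k)) \<cdot>\<^bsub>B\<^esub>
          (\<phi> a (Suc ?k) \<boxtimes>\<^bsub>B\<^esub> \<phi> b (Suc ?k)) =
        AMap F (?s \<boxtimes>\<^bsub>A\<^esub> Ident A ?ab) \<cdot>\<^bsub>B\<^esub> ((AMap F (middle_swap A ?A a ?B b) \<cdot>\<^bsub>B\<^esub>
          \<Phi> (?A \<otimes>\<^bsub>A\<^esub> a) (?B \<otimes>\<^bsub>A\<^esub> b) \<cdot>\<^bsub>B\<^esub> (\<Phi> ?A a \<boxtimes>\<^bsub>B\<^esub> \<Phi> ?B b)) \<cdot>\<^bsub>B\<^esub>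
          ((\<phi> a ?k \<boxtimes>\<^bsub>B\<^esub> ?i ?fa) \<boxtimes>\<^bsub>B\<^esub> (\<phi> b ?k \<boxtimes>\<^bsub>B\<^esub> ?i ?fb)))"
      by simp
    also have "\<dots> = AMap F (?s \<boxtimes>\<^bsub>A\<^esub> Ident A ?ab) \<cdot>\<^bsub>B\<^esub> (\<Phi> (?A \<otimes>\<^bsub>A\<^esub> ?B) ?ab \<cdot>\<^bsub>B\<^esub> ((\<Phi> ?A ?B \<boxtimes>\<^bsub>B\<^esub> \<Phi> a b) \<cdot>\<^bsub>B\<^esub>
        (middle_swap B (OMap F ?A) ?fa (OMap F ?B) ?fb \<cdot>\<^bsub>B\<^esub>
          ((\<phi> a ?k \<boxtimes>\<^bsub>B\<^esub> ?i ?fa) \<boxtimes>\<^bsub>B\<^esub> (\<phi> b ?k \<boxtimes>\<^bsub>B\<^esub> ?i ?fb)))))"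
      by (subst AMap_middle_swap) simp_all
    also have "\<dots> = AMap F (?s \<boxtimes>\<^bsub>A\<^esub> Ident A ?ab) \<cdot>\<^bsub>B\<^esub> (\<Phi> (?A \<otimes>\<^bsub>A\<^esub> ?B) ?ab \<cdot>\<^bsub>B\<^esub>
        (((\<Phi> ?A ?B \<cdot>\<^bsub>B\<^esub> (\<phi> a ?k \<boxtimes>\<^bsub>B\<^esub> \<phi> b ?k)) \<boxtimes>\<^bsub>B\<^esub> ?i (OMap F ?ab)) \<cdot>\<^bsub>B\<^esub> ?ms))"
      unfolding ms by (simp add: \<Phi>_ab)
    also have "\<dots> = \<Phi> (tpow A ?ab ?k) ?ab \<cdot>\<^bsub>B\<^esub> ((AMap F ?s \<boxtimes>\<^bsub>B\<^esub> ?i (OMap F ?ab)) \<cdot>\<^bsub>B\<^esub>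
        (((\<Phi> ?A ?B \<cdot>\<^bsub>B\<^esub> (\<phi> a ?k \<boxtimes>\<^bsub>B\<^esub> \<phi> b ?k)) \<boxtimes>\<^bsub>B\<^esub> ?i (OMap F ?ab)) \<cdot>\<^bsub>B\<^esub> ?ms))"
      using Strongator_naturality[of ?s "Ident A ?ab"] by (intro B.Comp_eq_extend) simp_all
    also have "\<dots> = \<Phi> (tpow A ?ab ?k) ?ab \<cdot>\<^bsub>B\<^esub>
        (((AMap F ?s \<cdot>\<^bsub>B\<^esub> \<Phi> ?A ?B \<cdot>\<^bsub>B\<^esub> (\<phi> a ?k \<boxtimes>\<^bsub>B\<^esub> \<phi> b ?k)) \<boxtimes>\<^bsub>B\<^esub> ?i (OMap F ?ab)) \<cdot>\<^bsub>B\<^esub> ?ms)"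
      by simp
    also have "\<dots> = \<phi> ?ab (Suc ?k) \<cdot>\<^bsub>B\<^esub> shuffle B ?fa ?fb (Suc ?k)"
      unfolding ge2(2) by simp
    finally show ?case .
  }
qed

end

section \<open>The lifted supply\<close>

context prop_supply
begin

abbreviation S where "S \<equiv> strictification C"
abbreviation F where "F \<equiv> tens_functor C"
abbreviation \<phi> where "\<phi> \<equiv> strongator_pow S C F"

text \<open>The strongators are entered in the form that the supply axioms prescribe; strictness
  makes them identities, see \<open>rebracket_S\<close>. Conjugation by \<open>\<phi>\<close> gives
  the arrow part its required endpoints.\<close>

definition lifted_supply :: "'o list \<Rightarrow> (nat, 'p, 'o list, 'o list \<times> 'm \<times> 'o list) monoidal_functor" where
  "lifted_supply L = \<lparr>
     OMap = tpow S L,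
     AMap = (\<lambda>\<mu>. (tpow S L (Dom P \<mu>),
       \<phi> L (Cod P \<mu>) \<cdot>\<^bsub>C\<^esub> AMap (s (tens C L)) \<mu> \<cdot>\<^bsub>C\<^esub> inv_arr C (\<phi> L (Dom P \<mu>)),
       tpow S L (Cod P \<mu>))),
     Strongator = (\<lambda>m n. rebracket S (replicate m L) (replicate n L)),
     UStrongator = Ident S (Unit S) \<rparr>"

abbreviation lift where "lift L \<equiv> AMap (lifted_supply L)"

sublocale S: symmetric_strict_monoidal_category S
  by (rule C.strictification_symmetric_strict)

sublocale F: strong_monoidal_functor_on_strict S C F
  using C.strong_monoidal_tens_functor
  by (simp add: strong_monoidal_functor_on_strict_def S.symmetric_strict_monoidal_category_axioms)

text \<open>From here on \<open>S\<close> is mostly handled abstractly, as a symmetric strict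
  monoidal category with a functor to \<open>C\<close>.\<close>

declare strictification_simps [simp del]

lemma Obj_P [simp]: "m \<in> Obj P"
  by (simp add: P.Obj_UNIV)

lemma Obj_S: "L \<in> Obj S \<longleftrightarrow> L \<in> lists (Obj C)"
  by (simp add: strictification_simps)

lemma tens_Obj_S [simp]: "L \<in> Obj S \<Longrightarrow> tens C L \<in> Obj C"
  by (simp add: Obj_S)

lemma supply_AMap [simp]:
  assumes "c \<in> Obj C" "\<mu> \<in> Arr P"
  shows "AMap (s c) \<mu> \<in> Arr C" "Dom C (AMap (s c) \<mu>) = tpow C c (Dom P \<mu>)"
    "Cod C (AMap (s c) \<mu>) = tpow C c (Cod P \<mu>)"
  using strong_monoidal_functor.AMap_type[OF supply_functor[OF assms(1)] assms(2)] assms(1)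
  by (simp_all add: supply_OMap)

lemma \<phi>_type [simp]:
  assumes "L \<in> Obj S"
  shows "invertible C (\<phi> L n)" "\<phi> L n \<in> Arr C"
    "Dom C (\<phi> L n) = tpow C (tens C L) n" "Cod C (\<phi> L n) = tens C (tpow S L n)"
  using F.strongator_pow_type[OF assms, of n] by simp_all

text \<open>An arrow of \<open>S\<close> is a triple of which the functor keeps only the middle
  component, so the endpoints have to agree separately. This allows equations in \<open>S\<close> to
  be checked in \<open>C\<close>.\<close>

lemma tens_functor_faithful:
  assumes "AMap F x = AMap F y" "x \<in> Arr S" "y \<in> Arr S" "Dom S x = Dom S y" "Cod S x = Cod S y"
  shows "x = y"
  using assms by (cases x; cases y) (auto simp: strictification_simps)

lemma AMap_lift:
  "AMap F (lift L \<mu>) = \<phi> L (Cod P \<mu>) \<cdot>\<^bsub>C\<^esub> AMap (s (tens C L)) \<mu> \<cdot>\<^bsub>C\<^esub> inv_arr C (\<phi> L (Dom P \<mu>))"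
  by (simp add: lifted_supply_def)

lemma lift_type [simp]:
  assumes "L \<in> Obj S" "\<mu> \<in> Arr P"
  shows "lift L \<mu> \<in> Arr S" "Dom S (lift L \<mu>) = tpow S L (Dom P \<mu>)"
    "Cod S (lift L \<mu>) = tpow S L (Cod P \<mu>)"
proof -
  have "tpow S L n \<in> lists (Obj C)" for n
    using S.tpow_Obj[OF assms(1)] by (simp add: Obj_S)
  then show "lift L \<mu> \<in> Arr S" "Dom S (lift L \<mu>) = tpow S L (Dom P \<mu>)"
    "Cod S (lift L \<mu>) = tpow S L (Cod P \<mu>)"
    using assms by (simp_all add: lifted_supply_def strictification_simps in_hom_iff)
qed

text \<open>The definition cleared of its inverse; in this form it is the preservation
  condition.\<close>

lemma AMap_lift_Comp:
  "L \<in> Obj S \<Longrightarrow> \<mu> \<in> Arr P \<Longrightarrow>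
    AMap F (lift L \<mu>) \<cdot>\<^bsub>C\<^esub> \<phi> L (Dom P \<mu>) = \<phi> L (Cod P \<mu>) \<cdot>\<^bsub>C\<^esub> AMap (s (tens C L)) \<mu>"
  by (simp add: AMap_lift)

section \<open>The lifted functors are strong monoidal\<close>

lemma lift_Ident:
  assumes [simp]: "L \<in> Obj S"
  shows "lift L (Ident P m) = Ident S (tpow S L m)"
proof (rule tens_functor_faithful)
  interpret T: strong_monoidal_functor P C "s (tens C L)" by (rule supply_functor) simp
  show "AMap F (lift L (Ident P m)) = AMap F (Ident S (tpow S L m))"
    by (simp add: AMap_lift supply_OMap)
qed simp_all

lemma lift_Comp:
  assumes [simp]: "L \<in> Obj S" "\<mu> \<in> Arr P" "\<nu> \<in> Arr P" "Dom P \<nu> = Cod P \<mu>"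
  shows "lift L (\<nu> \<cdot>\<^bsub>P\<^esub> \<mu>) = lift L \<nu> \<cdot>\<^bsub>S\<^esub> lift L \<mu>"
proof (rule tens_functor_faithful)
  interpret T: strong_monoidal_functor P C "s (tens C L)" by (rule supply_functor) simp
  show "AMap F (lift L (\<nu> \<cdot>\<^bsub>P\<^esub> \<mu>)) = AMap F (lift L \<nu> \<cdot>\<^bsub>S\<^esub> lift L \<mu>)"
    by (simp add: AMap_lift)
qed simp_all

lemma \<phi>_add:
  "L \<in> Obj S \<Longrightarrow> \<phi> L (m + n) \<cdot>\<^bsub>C\<^esub> rebracket C (replicate m (tens C L)) (replicate n (tens C L)) =
    rebracket C (tpow S L m) (tpow S L n) \<cdot>\<^bsub>C\<^esub> (\<phi> L m \<boxtimes>\<^bsub>C\<^esub> \<phi> L n)"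
  using F.strongator_pow_add[of L m n] by simp

lemma rebracket_replicate [simp]:
  assumes "c \<in> Obj C"
  shows "rebracket C (replicate m c) (replicate n c) \<in> Arr C"
    "invertible C (rebracket C (replicate m c) (replicate n c))"
    "Dom C (rebracket C (replicate m c) (replicate n c)) = tpow C c m \<otimes>\<^bsub>C\<^esub> tpow C c n"
    "Cod C (rebracket C (replicate m c) (replicate n c)) = tpow C c (m + n)"
  using C.rebracket_type[of "replicate m c" "replicate n c"] assms
  by (simp_all add: tpow_def in_lists_conv_set replicate_add)

lemma rebracket_type' [simp]:
  assumes "L \<in> Obj S" "M \<in> Obj S"
  shows "rebracket C L M \<in> Arr C" "invertible C (rebracket C L M)"
    "Dom C (rebracket C L M) = tens C L \<otimes>\<^bsub>C\<^esub> tens C M"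
    "Cod C (rebracket C L M) = tens C (L \<otimes>\<^bsub>S\<^esub> M)"
  using F.Strongator_type[OF assms] by simp_all

text \<open>Seen through \<open>\<phi>\<close>, naturality of the strongators of \<open>s\<close>
  becomes naturality of those of the tensor functor, with \<open>\<phi>_add\<close> relating the
  two. The comparison takes place after precomposition with the invertible map of
  \<open>\<phi>_add\<close>.\<close>

lemma lift_TensA:
  assumes [simp]: "L \<in> Obj S" "\<mu> \<in> Arr P" "\<nu> \<in> Arr P"
  shows "lift L (\<mu> \<boxtimes>\<^bsub>P\<^esub> \<nu>) = lift L \<mu> \<boxtimes>\<^bsub>S\<^esub> lift L \<nu>"
proof (rule tens_functor_faithful)
  interpret T: strong_monoidal_functor P C "s (tens C L)" by (rule supply_functor) simp
  let ?c = "tens C L"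
  let ?m = "Dom P \<mu>" and ?n = "Dom P \<nu>" and ?m' = "Cod P \<mu>" and ?n' = "Cod P \<nu>"
  let ?r = "\<lambda>m n. rebracket C (replicate m ?c) (replicate n ?c)"
  let ?R = "\<lambda>m n. rebracket C (tpow S L m) (tpow S L n)"
  have D: "Dom P (\<mu> \<boxtimes>\<^bsub>P\<^esub> \<nu>) = ?m + ?n" "Cod P (\<mu> \<boxtimes>\<^bsub>P\<^esub> \<nu>) = ?m' + ?n'"
    by (simp_all add: P.TensO_plus)
  have [simp]: "\<mu> \<boxtimes>\<^bsub>P\<^esub> \<nu> \<in> Arr P" by simp
  have st: "AMap (s ?c) (\<mu> \<boxtimes>\<^bsub>P\<^esub> \<nu>) \<cdot>\<^bsub>C\<^esub> ?r ?m ?n = ?r ?m' ?n' \<cdot>\<^bsub>C\<^esub> (AMap (s ?c) \<mu> \<boxtimes>\<^bsub>C\<^esub> AMap (s ?c) \<nu>)"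
    using T.Strongator_naturality[of \<mu> \<nu>] by (simp add: supply_Strongator)
  have "AMap F (lift L (\<mu> \<boxtimes>\<^bsub>P\<^esub> \<nu>)) \<cdot>\<^bsub>C\<^esub> (\<phi> L (?m + ?n) \<cdot>\<^bsub>C\<^esub> ?r ?m ?n) =
      \<phi> L (?m' + ?n') \<cdot>\<^bsub>C\<^esub> (AMap (s ?c) (\<mu> \<boxtimes>\<^bsub>P\<^esub> \<nu>) \<cdot>\<^bsub>C\<^esub> ?r ?m ?n)"
    using AMap_lift_Comp[of L "\<mu> \<boxtimes>\<^bsub>P\<^esub> \<nu>"] unfolding D 
    by (intro C.Comp_eq_extend) (simp_all add: P.TensO_plus del: F.AMap_Comp')
  also have "\<dots> = (\<phi> L (?m' + ?n') \<cdot>\<^bsub>C\<^esub> ?r ?m' ?n') \<cdot>\<^bsub>C\<^esub> (AMap (s ?c) \<mu> \<boxtimes>\<^bsub>C\<^esub> AMap (s ?c) \<nu>)"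
    unfolding st by simp
  also have "\<dots> = ?R ?m' ?n' \<cdot>\<^bsub>C\<^esub> ((\<phi> L ?m' \<cdot>\<^bsub>C\<^esub> AMap (s ?c) \<mu>) \<boxtimes>\<^bsub>C\<^esub> (\<phi> L ?n' \<cdot>\<^bsub>C\<^esub> AMap (s ?c) \<nu>))"
    unfolding \<phi>_add[OF assms(1)] by simp
  also have "\<dots> = (?R ?m' ?n' \<cdot>\<^bsub>C\<^esub> (AMap F (lift L \<mu>) \<boxtimes>\<^bsub>C\<^esub> AMap F (lift L \<nu>))) \<cdot>\<^bsub>C\<^esub> (\<phi> L ?m \<boxtimes>\<^bsub>C\<^esub> \<phi> L ?n)"
    unfolding AMap_lift_Comp[OF assms(1,2), symmetric] AMap_lift_Comp[OF assms(1,3), symmetric] by simp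
  also have "?R ?m' ?n' \<cdot>\<^bsub>C\<^esub> (AMap F (lift L \<mu>) \<boxtimes>\<^bsub>C\<^esub> AMap F (lift L \<nu>)) =
      AMap F (lift L \<mu> \<boxtimes>\<^bsub>S\<^esub> lift L \<nu>) \<cdot>\<^bsub>C\<^esub> ?R ?m ?n"
    using F.Strongator_naturality[of "lift L \<mu>" "lift L \<nu>"] by simp
  also have "\<dots> \<cdot>\<^bsub>C\<^esub> (\<phi> L ?m \<boxtimes>\<^bsub>C\<^esub> \<phi> L ?n) =
      AMap F (lift L \<mu> \<boxtimes>\<^bsub>S\<^esub> lift L \<nu>) \<cdot>\<^bsub>C\<^esub> (?R ?m ?n \<cdot>\<^bsub>C\<^esub> (\<phi> L ?m \<boxtimes>\<^bsub>C\<^esub> \<phi> L ?n))"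
    by simp
  also have "\<dots> = AMap F (lift L \<mu> \<boxtimes>\<^bsub>S\<^esub> lift L \<nu>) \<cdot>\<^bsub>C\<^esub> (\<phi> L (?m + ?n) \<cdot>\<^bsub>C\<^esub> ?r ?m ?n)"
    unfolding \<phi>_add[OF assms(1)] by simp
  finally show "AMap F (lift L (\<mu> \<boxtimes>\<^bsub>P\<^esub> \<nu>)) = AMap F (lift L \<mu> \<boxtimes>\<^bsub>S\<^esub> lift L \<nu>)"
    by (rule C.invertible_cancel_right) (simp_all add: P.TensO_plus S.tpow_add)
qed (simp_all add: P.TensO_plus S.tpow_add)

text \<open>The same transport as for tensors, with the braiding axioms of the two functors in place
  of naturality of their strongators.\<close>

lemma lift_Braid:
  assumes [simp]: "L \<in> Obj S"
  shows "lift L (Braid P m n) = Braid S (tpow S L m) (tpow S L n)"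
proof (rule tens_functor_faithful)
  interpret T: strong_monoidal_functor P C "s (tens C L)" by (rule supply_functor) simp
  let ?c = "tens C L"
  let ?r = "\<lambda>m n. rebracket C (replicate m ?c) (replicate n ?c)"
  let ?R = "\<lambda>m n. rebracket C (tpow S L m) (tpow S L n)"
  have D: "Dom P (Braid P m n) = m + n" "Cod P (Braid P m n) = n + m"
    by (simp_all add: P.TensO_plus)
  have st: "AMap (s ?c) (Braid P m n) \<cdot>\<^bsub>C\<^esub> ?r m n = ?r n m \<cdot>\<^bsub>C\<^esub> Braid C (tpow C ?c m) (tpow C ?c n)"
    using T.Strongator_Braid[of m n] by (simp add: supply_Strongator supply_OMap)
  have "AMap F (lift L (Braid P m n)) \<cdot>\<^bsub>C\<^esub> (\<phi> L (m + n) \<cdot>\<^bsub>C\<^esub> ?r m n) =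
      \<phi> L (n + m) \<cdot>\<^bsub>C\<^esub> (AMap (s ?c) (Braid P m n) \<cdot>\<^bsub>C\<^esub> ?r m n)"
    using AMap_lift_Comp[of L "Braid P m n"] unfolding D
    by (intro C.Comp_eq_extend) (simp_all add: P.TensO_plus)
  also have "\<dots> = (\<phi> L (n + m) \<cdot>\<^bsub>C\<^esub> ?r n m) \<cdot>\<^bsub>C\<^esub> Braid C (tpow C ?c m) (tpow C ?c n)"
    unfolding st by simp
  also have "\<dots> = ?R n m \<cdot>\<^bsub>C\<^esub> ((\<phi> L n \<boxtimes>\<^bsub>C\<^esub> \<phi> L m) \<cdot>\<^bsub>C\<^esub> Braid C (tpow C ?c m) (tpow C ?c n))"
    unfolding \<phi>_add[OF assms(1)] by simp
  also have "(\<phi> L n \<boxtimes>\<^bsub>C\<^esub> \<phi> L m) \<cdot>\<^bsub>C\<^esub> Braid C (tpow C ?c m) (tpow C ?c n) =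
      Braid C (tens C (tpow S L m)) (tens C (tpow S L n)) \<cdot>\<^bsub>C\<^esub> (\<phi> L m \<boxtimes>\<^bsub>C\<^esub> \<phi> L n)"
    using C.Braid_naturality[of "\<phi> L m" "\<phi> L n"] by simp
  also have "?R n m \<cdot>\<^bsub>C\<^esub> \<dots> = AMap F (Braid S (tpow S L m) (tpow S L n)) \<cdot>\<^bsub>C\<^esub> (?R m n \<cdot>\<^bsub>C\<^esub> (\<phi> L m \<boxtimes>\<^bsub>C\<^esub> \<phi> L n))"
    using F.Strongator_Braid[of "tpow S L m" "tpow S L n"] by (intro C.Comp_eq_extend) simp_all
  also have "\<dots> = AMap F (Braid S (tpow S L m) (tpow S L n)) \<cdot>\<^bsub>C\<^esub> (\<phi> L (m + n) \<cdot>\<^bsub>C\<^esub> ?r m n)"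
    unfolding \<phi>_add[OF assms(1)] by simp
  finally show "AMap F (lift L (Braid P m n)) = AMap F (Braid S (tpow S L m) (tpow S L n))"
    by (rule C.invertible_cancel_right) (simp_all add: P.TensO_plus S.tpow_add)
qed (simp_all add: P.TensO_plus S.tpow_add)

lemma rebracket_S:
  "L \<in> Obj S \<Longrightarrow> rebracket S (replicate m L) (replicate n L) = Ident S (tpow S L m \<otimes>\<^bsub>S\<^esub> tpow S L n)"
  by (simp add: S.rebracket_Ident tpow_def in_lists_conv_set)

lemma lifted_supply_simps [simp]:
  "OMap (lifted_supply L) = tpow S L"
  "UStrongator (lifted_supply L) = Ident S (Unit S)"
  "L \<in> Obj S \<Longrightarrow> Strongator (lifted_supply L) m n = Ident S (tpow S L m \<otimes>\<^bsub>S\<^esub> tpow S L n)"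
  by (simp_all add: lifted_supply_def rebracket_S)

text \<open>All strongators are identities of a strict category, so the axioms reduce to strict
  preservation of identities, composites, tensors and braidings.\<close>

lemma strong_monoidal_lifted_supply:
  assumes [simp]: "L \<in> Obj S"
  shows "strong_monoidal_functor P S (lifted_supply L)"
  by unfold_locales
    (auto simp: in_hom_iff in_isos_iff lift_Ident lift_Comp lift_TensA lift_Braid P.TensO_plus
      S.tpow_add P.Unit_zero)

section \<open>Compatibility of the lifted functors with the unit and with tensors\<close>

lemma lift_Unit:
  assumes [simp]: "\<mu> \<in> Arr P"
  shows "lift (Unit S) \<mu> = Ident S (Unit S)"
proof (rule tens_functor_faithful)
  let ?\<sigma> = "unit_shuffle C" and ?I = "Unit C" and ?i = "Ident C (Unit C)"
  have [simp]: "tens C (Unit S) = ?I" by (simp add: strictification_simps)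
  \<comment> \<open>For the empty list the iterated strongator undoes \<open>unit_shuffle C\<close>,
    so the unit axiom of \<open>s\<close> says that the conjugated arrow is an identity.\<close>
  have \<phi>: "\<phi> (Unit S) n \<cdot>\<^bsub>C\<^esub> ?\<sigma> n = ?i" for n
  proof (induction n rule: induct_nat_012)
    case (ge2 n)
    have [simp]: "rebracket C (Unit S) (Unit S) = LUnit C ?I"
      by (simp add: strictification_simps C.rebracket_Nil_left)
    have "\<phi> (Unit S) (Suc (Suc n)) \<cdot>\<^bsub>C\<^esub> ?\<sigma> (Suc (Suc n)) =
        LUnit C ?I \<cdot>\<^bsub>C\<^esub> (((\<phi> (Unit S) (Suc n) \<cdot>\<^bsub>C\<^esub> ?\<sigma> (Suc n)) \<boxtimes>\<^bsub>C\<^esub> ?i) \<cdot>\<^bsub>C\<^esub> inv_arr C (LUnit C ?I))"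
      by simp
    also have "\<dots> = ?i" unfolding ge2(2) by simp
    finally show ?case .
  qed simp_all
  have inv: "?\<sigma> n \<cdot>\<^bsub>C\<^esub> \<phi> (Unit S) n = Ident C (tpow C ?I n)" for n
  proof (rule C.invertible_cancel_right[where e = "?\<sigma> n"])
    show "(?\<sigma> n \<cdot>\<^bsub>C\<^esub> \<phi> (Unit S) n) \<cdot>\<^bsub>C\<^esub> ?\<sigma> n = Ident C (tpow C ?I n) \<cdot>\<^bsub>C\<^esub> ?\<sigma> n"
      using \<phi>[of n] by simp
  qed simp_all
  have "AMap F (lift (Unit S) \<mu>) \<cdot>\<^bsub>C\<^esub> (\<phi> (Unit S) (Dom P \<mu>) \<cdot>\<^bsub>C\<^esub> ?\<sigma> (Dom P \<mu>)) =
      \<phi> (Unit S) (Cod P \<mu>) \<cdot>\<^bsub>C\<^esub> (AMap (s ?I) \<mu> \<cdot>\<^bsub>C\<^esub> ?\<sigma> (Dom P \<mu>))"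
    using AMap_lift_Comp[of "Unit S" \<mu>] by (intro C.Comp_eq_extend) simp_all
  also have "\<dots> = ?i"
    using supply_unit[of \<mu> "Dom P \<mu>" "Cod P \<mu>"] by (simp add: in_hom_iff \<phi>)
  finally show "AMap F (lift (Unit S) \<mu>) = AMap F (Ident S (Unit S))"
    by (simp add: \<phi>)
qed simp_all

text \<open>Left bracketing makes \<open>tens C (L @ [c])\<close> literally
  \<open>tens C L \<otimes> c\<close> for nonempty L. The tensor axiom of \<open>s\<close> therefore
  concerns the very functor that is lifted, and \<open>strongator_pow_shuffle\<close> carries it
  over to \<open>S\<close>.\<close>

lemma lift_tensor_singleton:
  assumes [simp]: "L \<in> Obj S" "[c] \<in> Obj S" "\<mu> \<in> Arr P" and "L \<noteq> []"
  shows "lift (L \<otimes>\<^bsub>S\<^esub> [c]) \<mu> \<cdot>\<^bsub>S\<^esub> shuffle S L [c] (Dom P \<mu>) =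
    shuffle S L [c] (Cod P \<mu>) \<cdot>\<^bsub>S\<^esub> (lift L \<mu> \<boxtimes>\<^bsub>S\<^esub> lift [c] \<mu>)"
proof (rule tens_functor_faithful)
  let ?l = "tens C L" and ?m = "Dom P \<mu>" and ?n = "Cod P \<mu>" and ?K = "[c]"
  let ?LK = "L \<otimes>\<^bsub>S\<^esub> ?K"
  \<comment> \<open>The coherence map from \<open>(tens C L)^n \<otimes> c^n\<close> to the product
    of the concatenated powers; being invertible, it can be cancelled in the end.\<close>
  let ?E = "\<lambda>n. rebracket C (tpow S L n) (tpow S ?K n) \<cdot>\<^bsub>C\<^esub> (\<phi> L n \<boxtimes>\<^bsub>C\<^esub> \<phi> ?K n)"
  have [simp]: "c \<in> Obj C" "tens C [c] = c"
    using tens_Obj_S[of "[c]"] by simp_all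
  have LK [simp]: "tens C ?LK = ?l \<otimes>\<^bsub>C\<^esub> c"
    using assms(4) by (simp add: strictification_simps)
  \<comment> \<open>Here L has to be nonempty: only then is the rebracketing of L with
    \<open>[c]\<close> an identity.\<close>
  have Q: "AMap F (shuffle S L ?K n) \<cdot>\<^bsub>C\<^esub> ?E n = \<phi> ?LK n \<cdot>\<^bsub>C\<^esub> shuffle C ?l c n" for n
    using F.strongator_pow_shuffle[of L ?K n] assms(4) by (simp add: rebracket_simps(3))
  have E [simp]: "?E n \<in> Arr C" "Dom C (?E n) = tpow C ?l n \<otimes>\<^bsub>C\<^esub> tpow C c n"
    "Cod C (?E n) = tens C (tpow S L n \<otimes>\<^bsub>S\<^esub> tpow S ?K n)" "invertible C (?E n)" for n
    by simp_all
  have "AMap F (lift ?LK \<mu> \<cdot>\<^bsub>S\<^esub> shuffle S L ?K ?m) \<cdot>\<^bsub>C\<^esub> ?E ?m =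
      AMap F (lift ?LK \<mu>) \<cdot>\<^bsub>C\<^esub> (AMap F (shuffle S L ?K ?m) \<cdot>\<^bsub>C\<^esub> ?E ?m)"
    by simp
  also have "\<dots> = \<phi> ?LK ?n \<cdot>\<^bsub>C\<^esub> (AMap (s (?l \<otimes>\<^bsub>C\<^esub> c)) \<mu> \<cdot>\<^bsub>C\<^esub> shuffle C ?l c ?m)"
    unfolding Q using AMap_lift_Comp[of ?LK \<mu>] by (intro C.Comp_eq_extend) simp_all
  also have "\<dots> = (\<phi> ?LK ?n \<cdot>\<^bsub>C\<^esub> shuffle C ?l c ?n) \<cdot>\<^bsub>C\<^esub> (AMap (s ?l) \<mu> \<boxtimes>\<^bsub>C\<^esub> AMap (s c) \<mu>)"
    using supply_tensor[of ?l c \<mu> ?m ?n] by (simp add: in_hom_iff)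
  also have "\<dots> = AMap F (shuffle S L ?K ?n) \<cdot>\<^bsub>C\<^esub> (rebracket C (tpow S L ?n) (tpow S ?K ?n) \<cdot>\<^bsub>C\<^esub>
      ((\<phi> L ?n \<cdot>\<^bsub>C\<^esub> AMap (s ?l) \<mu>) \<boxtimes>\<^bsub>C\<^esub> (\<phi> ?K ?n \<cdot>\<^bsub>C\<^esub> AMap (s c) \<mu>)))"
    unfolding Q[symmetric] by simp
  also have "(\<phi> L ?n \<cdot>\<^bsub>C\<^esub> AMap (s ?l) \<mu>) \<boxtimes>\<^bsub>C\<^esub> (\<phi> ?K ?n \<cdot>\<^bsub>C\<^esub> AMap (s c) \<mu>) =
      (AMap F (lift L \<mu>) \<boxtimes>\<^bsub>C\<^esub> AMap F (lift ?K \<mu>)) \<cdot>\<^bsub>C\<^esub> (\<phi> L ?m \<boxtimes>\<^bsub>C\<^esub> \<phi> ?K ?m)"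
    using AMap_lift_Comp[of L \<mu>] AMap_lift_Comp[of ?K \<mu>] by simp
  also have "rebracket C (tpow S L ?n) (tpow S ?K ?n) \<cdot>\<^bsub>C\<^esub> \<dots> =
      AMap F (lift L \<mu> \<boxtimes>\<^bsub>S\<^esub> lift ?K \<mu>) \<cdot>\<^bsub>C\<^esub> ?E ?m"
    using F.Strongator_naturality[of "lift L \<mu>" "lift ?K \<mu>"] by (intro C.Comp_eq_extend) simp_all
  also have "AMap F (shuffle S L ?K ?n) \<cdot>\<^bsub>C\<^esub> \<dots> =
      AMap F (shuffle S L ?K ?n \<cdot>\<^bsub>S\<^esub> (lift L \<mu> \<boxtimes>\<^bsub>S\<^esub> lift ?K \<mu>)) \<cdot>\<^bsub>C\<^esub> ?E ?m"
    by simp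
  finally show "AMap F (lift ?LK \<mu> \<cdot>\<^bsub>S\<^esub> shuffle S L ?K ?m) =
      AMap F (shuffle S L ?K ?n \<cdot>\<^bsub>S\<^esub> (lift L \<mu> \<boxtimes>\<^bsub>S\<^esub> lift ?K \<mu>))"
    by (rule C.invertible_cancel_right) simp_all
qed simp_all

text \<open>Induction on the right list, where \<open>S.shuffle_assoc\<close> replaces the pair (L,
  M @ [c]) by the pairs (L @ M, [c]), (L, M) and (M, [c]). Two of these are singleton cases and the
  third is the induction hypothesis.\<close>

lemma lift_tensor:
  assumes [simp]: "L \<in> Obj S" "\<mu> \<in> Arr P" and "M \<in> Obj S"
  shows "lift (L \<otimes>\<^bsub>S\<^esub> M) \<mu> \<cdot>\<^bsub>S\<^esub> shuffle S L M (Dom P \<mu>) =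
    shuffle S L M (Cod P \<mu>) \<cdot>\<^bsub>S\<^esub> (lift L \<mu> \<boxtimes>\<^bsub>S\<^esub> lift M \<mu>)"
proof (cases "L = []")
  \<comment> \<open>The singleton lemma excludes an empty left list, but there the shuffles and the
    lifted arrow of the unit are identities.\<close>
  case True
  then have "L = Unit S" by (simp add: strictification_simps)
  then show ?thesis using assms(3) by (simp add: S.shuffle_Unit_left lift_Unit)
next
  case False
  from assms(3) show ?thesis
  proof (induction M rule: rev_induct)
    case Nil
    have Nil: "[] = Unit S" by (simp add: strictification_simps)
    show ?case unfolding Nil by (simp add: S.shuffle_Unit_right lift_Unit)
  next
    case (snoc c M)
    then have [simp]: "M \<in> Obj S" "[c] \<in> Obj S" by (simp_all add: Obj_S)
    let ?\<sigma> = "\<lambda>L M. shuffle S L M (Dom P \<mu>)" and ?\<tau> = "\<lambda>L M. shuffle S L M (Cod P \<mu>)"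
    let ?t = "\<lambda>L. lift L \<mu>" and ?c = "[c]"
    have Mc: "M @ [c] = M \<otimes>\<^bsub>S\<^esub> [c]" by (simp add: strictification_simps)
    show ?case
    \<comment> \<open>The pair (M, [c]) is a singleton case only for nonempty M; for empty M the
      goal is itself the singleton case of L and \<open>[c]\<close>.\<close>
    proof (cases "M = []")
      case True
      then show ?thesis using lift_tensor_singleton[of L c \<mu>] False by simp
    next
      case M: False
      have LM: "L \<otimes>\<^bsub>S\<^esub> M \<noteq> []" using False by (simp add: strictification_simps)
      let ?i = "\<lambda>L. Ident S (tpow S L (Dom P \<mu>))" and ?j = "\<lambda>L. Ident S (tpow S L (Cod P \<mu>))"
      \<comment> \<open>Composing with the invertible \<open>?i L \<boxtimes> ?\<sigma> M ?c\<close>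
        completes the shuffle of M @ [c] into L to a shuffle of three lists, to which associativity
        applies.\<close>
      have "(?t (L \<otimes>\<^bsub>S\<^esub> (M \<otimes>\<^bsub>S\<^esub> ?c)) \<cdot>\<^bsub>S\<^esub> ?\<sigma> L (M \<otimes>\<^bsub>S\<^esub> ?c)) \<cdot>\<^bsub>S\<^esub> (?i L \<boxtimes>\<^bsub>S\<^esub> ?\<sigma> M ?c) =
          ?t (L \<otimes>\<^bsub>S\<^esub> (M \<otimes>\<^bsub>S\<^esub> ?c)) \<cdot>\<^bsub>S\<^esub> (?\<sigma> L (M \<otimes>\<^bsub>S\<^esub> ?c) \<cdot>\<^bsub>S\<^esub> (?i L \<boxtimes>\<^bsub>S\<^esub> ?\<sigma> M ?c))"
        by (rule S.Comp_assoc_right) simp_all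
      also have "\<dots> = ?t ((L \<otimes>\<^bsub>S\<^esub> M) \<otimes>\<^bsub>S\<^esub> ?c) \<cdot>\<^bsub>S\<^esub>
          (?\<sigma> (L \<otimes>\<^bsub>S\<^esub> M) ?c \<cdot>\<^bsub>S\<^esub> (?\<sigma> L M \<boxtimes>\<^bsub>S\<^esub> ?i ?c))"
        by (subst S.shuffle_assoc) simp_all
      also have "\<dots> = ?\<tau> (L \<otimes>\<^bsub>S\<^esub> M) ?c \<cdot>\<^bsub>S\<^esub> ((?t (L \<otimes>\<^bsub>S\<^esub> M) \<boxtimes>\<^bsub>S\<^esub> ?t ?c) \<cdot>\<^bsub>S\<^esub>
          (?\<sigma> L M \<boxtimes>\<^bsub>S\<^esub> ?i ?c))"
        using lift_tensor_singleton[of "L \<otimes>\<^bsub>S\<^esub> M" c \<mu>] LM by (intro S.Comp_eq_extend) simp_all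
      also have "(?t (L \<otimes>\<^bsub>S\<^esub> M) \<boxtimes>\<^bsub>S\<^esub> ?t ?c) \<cdot>\<^bsub>S\<^esub> (?\<sigma> L M \<boxtimes>\<^bsub>S\<^esub> ?i ?c) =
          (?\<tau> L M \<boxtimes>\<^bsub>S\<^esub> ?j ?c) \<cdot>\<^bsub>S\<^esub> ((?t L \<boxtimes>\<^bsub>S\<^esub> ?t M) \<boxtimes>\<^bsub>S\<^esub> ?t ?c)"
        using snoc.IH by (simp del: S.TensA_assoc)
      also have "?\<tau> (L \<otimes>\<^bsub>S\<^esub> M) ?c \<cdot>\<^bsub>S\<^esub> \<dots> =
          ?\<tau> L (M \<otimes>\<^bsub>S\<^esub> ?c) \<cdot>\<^bsub>S\<^esub> ((?j L \<boxtimes>\<^bsub>S\<^esub> ?\<tau> M ?c) \<cdot>\<^bsub>S\<^esub> ((?t L \<boxtimes>\<^bsub>S\<^esub> ?t M) \<boxtimes>\<^bsub>S\<^esub> ?t ?c))"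
        using S.shuffle_assoc[of L M ?c "Cod P \<mu>"] by (intro S.Comp_eq_extend) simp_all
      \<comment> \<open>The square for (M, [c]) is read from right to left, which restores the
        factor attached at the start so that it can be cancelled.\<close>
      also have "(?j L \<boxtimes>\<^bsub>S\<^esub> ?\<tau> M ?c) \<cdot>\<^bsub>S\<^esub> ((?t L \<boxtimes>\<^bsub>S\<^esub> ?t M) \<boxtimes>\<^bsub>S\<^esub> ?t ?c) =
          (?t L \<boxtimes>\<^bsub>S\<^esub> ?t (M \<otimes>\<^bsub>S\<^esub> ?c)) \<cdot>\<^bsub>S\<^esub> (?i L \<boxtimes>\<^bsub>S\<^esub> ?\<sigma> M ?c)"
        using lift_tensor_singleton[of M c \<mu>] M by simp
      also have "?\<tau> L (M \<otimes>\<^bsub>S\<^esub> ?c) \<cdot>\<^bsub>S\<^esub> \<dots> =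
          (?\<tau> L (M \<otimes>\<^bsub>S\<^esub> ?c) \<cdot>\<^bsub>S\<^esub> (?t L \<boxtimes>\<^bsub>S\<^esub> ?t (M \<otimes>\<^bsub>S\<^esub> ?c))) \<cdot>\<^bsub>S\<^esub> (?i L \<boxtimes>\<^bsub>S\<^esub> ?\<sigma> M ?c)"
        by (rule S.Comp_assoc_right[symmetric]) simp_all
      finally show ?thesis
        unfolding Mc by (rule S.invertible_cancel_right) simp_all
    qed
  qed
qed

theorem lifted_supply: "prop_supply P S lifted_supply"
proof (intro prop_supply.intro prop_supply_axioms.intro)
  show "prop_category P" "symmetric_monoidal_category S"
    by (rule P.prop_category_axioms S.symmetric_monoidal_category_axioms)+
next
  fix L M \<mu> m n
  assume "L \<in> Obj S" "M \<in> Obj S" "\<mu> \<in> hom P m n"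
  then show "lift (L \<otimes>\<^bsub>S\<^esub> M) \<mu> \<cdot>\<^bsub>S\<^esub> shuffle S L M m = shuffle S L M n \<cdot>\<^bsub>S\<^esub> (lift L \<mu> \<boxtimes>\<^bsub>S\<^esub> lift M \<mu>)"
    using lift_tensor[of L \<mu> M] by (auto simp: in_hom_iff)
next
  fix \<mu> m n
  assume "\<mu> \<in> hom P m n"
  then show "lift (Unit S) \<mu> \<cdot>\<^bsub>S\<^esub> unit_shuffle S m = unit_shuffle S n"
    by (auto simp: in_hom_iff lift_Unit S.unit_shuffle_strict)
qed (simp_all add: strong_monoidal_lifted_supply rebracket_S)

theorem preserves_lifted_supply: "preserves_supply P S lifted_supply C s F"
  unfolding preserves_supply_def
  using C.strong_monoidal_tens_functor AMap_lift_Comp by (auto simp: in_hom_iff)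

end

theorem proposition3p28:
  fixes C :: "('o, 'm) smc"
    and P :: "(nat, 'p) smc"
    and s :: "'o \<Rightarrow> (nat, 'p, 'o, 'm) monoidal_functor"
  assumes "symmetric_monoidal_category C"
    and "prop_category P"
    and "prop_supply P C s"
  shows "\<exists>s' :: 'o list \<Rightarrow> (nat, 'p, 'o list, 'o list \<times> 'm \<times> 'o list) monoidal_functor.
           prop_supply P (strictification C) s' \<and>
           preserves_supply P (strictification C) s' C s (tens_functor C)"
  using prop_supply.lifted_supply[OF assms(3)] prop_supply.preserves_lifted_supply[OF assms(3)]
  by blast

end
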